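(* Suppose that $\mathcal J$ is a norm on $\mathcal V=\{u\in L^1:\mathcal J(u)<+\infty\}$ and that the convergence assumption, the source condition and the non-empty interior assumption (all stated in the context) hold. Let $(\lambda_n,\mu_n)$ be a solution of the dual problem $$\max_{\lambda\geq0,\ \mu\geq0}\ (\mu,-\phi_n)\quad\text{s.t. }\lambda-B_n^*\mu\in\partial\mathcal J(0),$$ and put $p_n=\lambda_n-B_n^*\mu_n$. Then, along a subsequence (not relabelled), $$p_n\rightharpoonup^*\hat p\quad\text{in }\mathcal V^*,$$ and $\hat p\in\partial\mathcal J_{\mathcal V^*}(\bar u_{\mathcal J})$ for all $\mathcal J$-minimising solutions $\bar u_{\mathcal J}$. Moreover, along a subsequence, $\lambda_n\rightharpoonup^*\hat\lambda$ in $\mathcal V^*$, where $(\hat\lambda,u)\geq0$ for any $u\in\mathcal V$ with $u\geq0$, and $(\hat\lambda,\bar u_{\mathcal J})=0$.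
   Context: $\Omega\subset\mathbb R^m$ is a bounded domain, $L^1=L^1(\Omega)$, $L^\infty=L^\infty(\Omega)$, $\mathbf 1$ is the constant function one, and $(\cdot,\cdot)$ denotes duality pairings (between $L^1$ and $L^\infty$, between $L^\infty$ and $(L^\infty)^*$, and between $\mathcal V$ and $\mathcal V^*$). Functions are ordered a.e. pointwise; for regular linear operators $L^1\to L^\infty$ (differences of two positive operators), $S\geq T$ means that $(S-T)u\geq0$ for all $u\geq 0$; $\mu\in(L^\infty)^*$ satisfies $\mu\geq0$ iff $(\mu,\psi)\geq0$ for all $0\leq\psi\in L^\infty$; pairs are ordered componentwise and an inequality between a pair and a scalar function is meant componentwise. $A\colon L^1\to L^\infty$ is a linear operator and $f\in L^\infty$. Sequences of bounds satisfy $f^l_n\leq f\leq f^u_n$, $f^l_{n+1}\geq f^l_n$, $f^u_{n+1}\leq f^u_n$, $A^l_n\leq A\leq A^u_n$, $A^l_{n+1}\geq A^l_n$, $A^u_{n+1}\leq A^u_n$, $\|f^u_n-f^l_n\|_\infty\to0$, $\|A^u_n-A^l_n\|\to0$. Put $B_nu=(A^l_nu,-A^u_nu)$, $\phi_n=(f^u_n,-f^l_n)$, $\bar Bu=(Au,-Au)$, $\bar\phi=(f,-f)$. In dual problems $\lambda\in L^\infty$, $\mu\in(L^\infty)^*\times(L^\infty)^*$, and $B_n^*,\bar B^*\colon(L^\infty)^*\times(L^\infty)^*\to L^\infty$ are the adjoints. $\mathcal J\colon L^1\to[0,\infty]$ is convex, proper and absolutely one-homogeneous. $\partial\mathcal J(u)=\{p\in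 L^\infty:\ \mathcal J(v)\geq(p,v)\ \forall v\in L^1,\ \mathcal J(u)=(p,u)\}$, so $\partial\mathcal J(0)=\{p\in L^\infty:\mathcal J(v)\geq(p,v)\ \forall v\in L^1\}$. $\mathcal V^*$ is the dual of the normed space $(\mathcal V,\mathcal J)$, and $\partial\mathcal J_{\mathcal V^*}(u)=\{p\in\mathcal V^*:\ \mathcal J(v)\geq(p,v)\ \forall v\in\mathcal V,\ \mathcal J(u)=(p,u)\}$ is the subdifferential of $\mathcal J$ considered on $\mathcal V$. Elements of $L^\infty$ act on $\mathcal V\subset L^1$ through the $L^\infty$–$L^1$ pairing. Standing assumption: $Au=f$ has a non-negative solution with finite $\mathcal J$, and $\bar u_{\mathcal J}$ denotes a (possibly non-unique) $\mathcal J$-minimising solution, i.e. a minimiser of $\mathcal J(u)$ over $u\in L^1$, $u\geq0$, $Au=f$. Convergence assumption: there are sequences $\varepsilon_n\downarrow0$, $\eta_n\downarrow0$ and constants $C_0\geq1$, $D_0>0$ with $\varepsilon_n\mathbf 1\leq\phi_n-\bar\phi\leq C_0\varepsilon_n\mathbf 1$, $\|\bar B-B_n\|_{L^1\to L^\infty}\leq\eta_n$, and $\limsup_{n\to\infty}\eta_n/\varepsilon_n\leq D_0$. Source condition: there exists $\bar\mu\in(L^\infty)^*\times(L^\infty)^*$, $\bar\mu\geq0$, with $-\bar B^*\bar\mu\in\partial\mathcal J(\bar u_{\mathcal J})$. Non-empty interior assumption: $0$ is an interior point of $\partial\mathcal J(0)$ in the norm topology of $L^\infty$.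
   Formalization: "Along a subsequence" is read as along a generalised subsequence (subnet), common to p_n and λ_n, which is an ordinary subsequence whenever (V,J) is separable; for non-separable V the claim with ordinary subsequences can fail. *)

theory Defs
  imports "HOL-Probability.Essential_Supremum"
begin

text \<open>Elements of $L^1(\Omega)$ and $L^\infty(\Omega)$ are handled through representatives:
  functions on the ambient space, of which only the values on $\Omega$ up to Lebesgue null sets
  matter. Operators and functionals on these spaces are required to respect equality almost
  everywhere.\<close>

type_synonym 'm func = "real ^ 'm \<Rightarrow> real"
type_synonym 'm functional = "'m func \<Rightarrow> real"

definition bounded_domain :: "(real ^ 'm::finite) set \<Rightarrow> bool" where
  "bounded_domain \<Omega> \<longleftrightarrow> open \<Omega> \<and> connected \<Omega> \<and> \<Omega> \<noteq> {} \<and> bounded \<Omega>"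

definition ae_eq :: "(real ^ 'm::finite) set \<Rightarrow> 'm func \<Rightarrow> 'm func \<Rightarrow> bool" where
  "ae_eq \<Omega> u v \<longleftrightarrow> (AE x in lebesgue_on \<Omega>. u x = v x)"

definition ae_le :: "(real ^ 'm::finite) set \<Rightarrow> 'm func \<Rightarrow> 'm func \<Rightarrow> bool" where
  "ae_le \<Omega> u v \<longleftrightarrow> (AE x in lebesgue_on \<Omega>. u x \<le> v x)"

abbreviation ae_nonneg :: "(real ^ 'm::finite) set \<Rightarrow> 'm func \<Rightarrow> bool" where
  "ae_nonneg \<Omega> u \<equiv> ae_le \<Omega> (\<lambda>_. 0) u"


subsection \<open>The spaces, their norms and the duality pairings\<close>

definition L1 :: "(real ^ 'm::finite) set \<Rightarrow> 'm func set" where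
  "L1 \<Omega> = {u. integrable (lebesgue_on \<Omega>) u}"

definition l1_norm :: "(real ^ 'm::finite) set \<Rightarrow> 'm func \<Rightarrow> real" where
  "l1_norm \<Omega> u = (LINT x|lebesgue_on \<Omega>. \<bar>u x\<bar>)"

definition linf_norm :: "(real ^ 'm::finite) set \<Rightarrow> 'm func \<Rightarrow> ereal" where
  "linf_norm \<Omega> g = esssup (lebesgue_on \<Omega>) (\<lambda>x. ereal \<bar>g x\<bar>)"

definition Linf :: "(real ^ 'm::finite) set \<Rightarrow> 'm func set" where
  "Linf \<Omega> = {g. g \<in> borel_measurable (lebesgue_on \<Omega>) \<and> linf_norm \<Omega> g < \<infinity>}"

text \<open>The norm on $L^\infty \times L^\infty$.\<close>

definition linf_norm2 :: "(real ^ 'm::finite) set \<Rightarrow> 'm func \<times> 'm func \<Rightarrow> ereal" where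
  "linf_norm2 \<Omega> gh = max (linf_norm \<Omega> (fst gh)) (linf_norm \<Omega> (snd gh))"

definition pairing :: "(real ^ 'm::finite) set \<Rightarrow> 'm func \<Rightarrow> 'm func \<Rightarrow> real" where
  "pairing \<Omega> p u = (LINT x|lebesgue_on \<Omega>. p x * u x)"

text \<open>The dual of $L^\infty$; boundedness already forces equal values on functions that are equal
  almost everywhere.\<close>

definition Linf_dual :: "(real ^ 'm::finite) set \<Rightarrow> 'm functional set" where
  "Linf_dual \<Omega> = {m.
     (\<forall>g\<in>Linf \<Omega>. \<forall>h\<in>Linf \<Omega>. m (\<lambda>x. g x + h x) = m g + m h) \<and>
     (\<forall>c. \<forall>g\<in>Linf \<Omega>. m (\<lambda>x. c * g x) = c * m g) \<and>
     (\<exists>C. \<forall>g\<in>Linf \<Omega>. ereal \<bar>m g\<bar> \<le> ereal C * linf_norm \<Omega> g)}"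

definition functional_nonneg :: "(real ^ 'm::finite) set \<Rightarrow> 'm functional \<Rightarrow> bool" where
  "functional_nonneg \<Omega> m \<longleftrightarrow> (\<forall>\<psi>\<in>Linf \<Omega>. ae_nonneg \<Omega> \<psi> \<longrightarrow> 0 \<le> m \<psi>)"

text \<open>Non-negative elements of $(L^\infty)^* \times (L^\infty)^*$.\<close>

definition nonneg_multiplier :: "(real ^ 'm::finite) set \<Rightarrow> 'm functional \<times> 'm functional \<Rightarrow> bool" where
  "nonneg_multiplier \<Omega> \<mu> \<longleftrightarrow>
     fst \<mu> \<in> Linf_dual \<Omega> \<and> snd \<mu> \<in> Linf_dual \<Omega> \<and>
     functional_nonneg \<Omega> (fst \<mu>) \<and> functional_nonneg \<Omega> (snd \<mu>)"

definition dpairing :: "'m functional \<times> 'm functional \<Rightarrow> 'm func \<times> 'm func \<Rightarrow> real" where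
  "dpairing \<mu> gh = fst \<mu> (fst gh) + snd \<mu> (snd gh)"


subsection \<open>Operators\<close>

definition linear_op :: "(real ^ 'm::finite) set \<Rightarrow> ('m func \<Rightarrow> 'm func) \<Rightarrow> bool" where
  "linear_op \<Omega> T \<longleftrightarrow>
     (\<forall>u\<in>L1 \<Omega>. T u \<in> Linf \<Omega>) \<and>
     (\<forall>u\<in>L1 \<Omega>. \<forall>v\<in>L1 \<Omega>. ae_eq \<Omega> u v \<longrightarrow> ae_eq \<Omega> (T u) (T v)) \<and>
     (\<forall>u\<in>L1 \<Omega>. \<forall>v\<in>L1 \<Omega>. ae_eq \<Omega> (T (\<lambda>x. u x + v x)) (\<lambda>x. T u x + T v x)) \<and>
     (\<forall>c. \<forall>u\<in>L1 \<Omega>. ae_eq \<Omega> (T (\<lambda>x. c * u x)) (\<lambda>x. c * T u x))"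

definition op_le :: "(real ^ 'm::finite) set \<Rightarrow> ('m func \<Rightarrow> 'm func) \<Rightarrow> ('m func \<Rightarrow> 'm func) \<Rightarrow> bool" where
  "op_le \<Omega> T S \<longleftrightarrow> (\<forall>u\<in>L1 \<Omega>. ae_nonneg \<Omega> u \<longrightarrow> ae_nonneg \<Omega> (\<lambda>x. S u x - T u x))"

definition positive_op :: "(real ^ 'm::finite) set \<Rightarrow> ('m func \<Rightarrow> 'm func) \<Rightarrow> bool" where
  "positive_op \<Omega> T \<longleftrightarrow> linear_op \<Omega> T \<and> (\<forall>u\<in>L1 \<Omega>. ae_nonneg \<Omega> u \<longrightarrow> ae_nonneg \<Omega> (T u))"

definition regular_op :: "(real ^ 'm::finite) set \<Rightarrow> ('m func \<Rightarrow> 'm func) \<Rightarrow> bool" where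
  "regular_op \<Omega> T \<longleftrightarrow> linear_op \<Omega> T \<and>
     (\<exists>P Q. positive_op \<Omega> P \<and> positive_op \<Omega> Q \<and>
            (\<forall>u\<in>L1 \<Omega>. ae_eq \<Omega> (T u) (\<lambda>x. P u x - Q u x)))"

text \<open>Operator norm for operators on $L^1$; the argument \<open>N\<close> is the norm of the target space.\<close>

definition op_norm :: "(real ^ 'm::finite) set \<Rightarrow> ('b \<Rightarrow> ereal) \<Rightarrow> ('m func \<Rightarrow> 'b) \<Rightarrow> ereal" where
  "op_norm \<Omega> N T = (SUP u\<in>{u \<in> L1 \<Omega>. l1_norm \<Omega> u \<le> 1}. N (T u))"

text \<open>With \<open>L = A\<^sup>l\<^sub>n\<close>, \<open>U = A\<^sup>u\<^sub>n\<close> this is $B_n$; with \<open>L = U = A\<close> it is $\bar B$.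
  Likewise \<open>data_pair fu fl\<close> is $\phi_n$, and \<open>data_pair f f\<close> is $\bar\phi$.\<close>

definition op_pair :: "('m func \<Rightarrow> 'm func) \<Rightarrow> ('m func \<Rightarrow> 'm func) \<Rightarrow> 'm func \<Rightarrow> 'm func \<times> 'm func" where
  "op_pair L U u = (L u, \<lambda>x. - U u x)"

definition data_pair :: "'m func \<Rightarrow> 'm func \<Rightarrow> 'm func \<times> 'm func" where
  "data_pair fu fl = (fu, \<lambda>x. - fl x)"

definition pair_diff :: "'m func \<times> 'm func \<Rightarrow> 'm func \<times> 'm func \<Rightarrow> 'm func \<times> 'm func" where
  "pair_diff a b = (\<lambda>x. fst a x - fst b x, \<lambda>x. snd a x - snd b x)"

definition pair_neg :: "'m func \<times> 'm func \<Rightarrow> 'm func \<times> 'm func" where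
  "pair_neg a = (\<lambda>x. - fst a x, \<lambda>x. - snd a x)"

text \<open>The adjoint $B^*\mu$ as an element of $L^\infty = (L^1)^*$. For regular operators the
  representing function exists and is unique up to null sets.\<close>

definition adjoint_op ::
  "(real ^ 'm::finite) set \<Rightarrow> ('m func \<Rightarrow> 'm func \<times> 'm func) \<Rightarrow> 'm functional \<times> 'm functional \<Rightarrow> 'm func" where
  "adjoint_op \<Omega> B \<mu> = (SOME q. q \<in> Linf \<Omega> \<and> (\<forall>u\<in>L1 \<Omega>. pairing \<Omega> q u = dpairing \<mu> (B u)))"


subsection \<open>The regulariser\<close>

text \<open>Convex, proper, absolutely one-homogeneous functionals $L^1 \to [0,\infty]$. The conventions
  \<open>0 * \<infinity> = 0\<close> of \<^typ>\<open>ereal\<close> are the right ones here.\<close>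

definition regulariser :: "(real ^ 'm::finite) set \<Rightarrow> ('m func \<Rightarrow> ereal) \<Rightarrow> bool" where
  "regulariser \<Omega> J \<longleftrightarrow>
     (\<forall>u\<in>L1 \<Omega>. 0 \<le> J u) \<and>
     (\<forall>u\<in>L1 \<Omega>. \<forall>v\<in>L1 \<Omega>. ae_eq \<Omega> u v \<longrightarrow> J u = J v) \<and>
     (\<forall>u\<in>L1 \<Omega>. \<forall>v\<in>L1 \<Omega>. \<forall>t. 0 \<le> t \<and> t \<le> 1 \<longrightarrow>
        J (\<lambda>x. (1 - t) * u x + t * v x) \<le> ereal (1 - t) * J u + ereal t * J v) \<and>
     (\<exists>u\<in>L1 \<Omega>. J u < \<infinity>) \<and>
     (\<forall>c. \<forall>u\<in>L1 \<Omega>. J (\<lambda>x. c * u x) = ereal \<bar>c\<bar> * J u)"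

definition fin_space :: "(real ^ 'm::finite) set \<Rightarrow> ('m func \<Rightarrow> ereal) \<Rightarrow> 'm func set" where
  "fin_space \<Omega> J = {u \<in> L1 \<Omega>. J u < \<infinity>}"

definition is_norm_on_fin_space :: "(real ^ 'm::finite) set \<Rightarrow> ('m func \<Rightarrow> ereal) \<Rightarrow> bool" where
  "is_norm_on_fin_space \<Omega> J \<longleftrightarrow>
     (\<forall>u\<in>fin_space \<Omega> J. 0 \<le> J u \<and> (J u = 0 \<longleftrightarrow> ae_eq \<Omega> u (\<lambda>_. 0))) \<and>
     (\<forall>u\<in>fin_space \<Omega> J. \<forall>v\<in>fin_space \<Omega> J. J (\<lambda>x. u x + v x) \<le> J u + J v) \<and>
     (\<forall>c. \<forall>u\<in>fin_space \<Omega> J. J (\<lambda>x. c * u x) = ereal \<bar>c\<bar> * J u)"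

definition fin_dual :: "(real ^ 'm::finite) set \<Rightarrow> ('m func \<Rightarrow> ereal) \<Rightarrow> 'm functional set" where
  "fin_dual \<Omega> J = {q.
     (\<forall>u\<in>fin_space \<Omega> J. \<forall>v\<in>fin_space \<Omega> J. q (\<lambda>x. u x + v x) = q u + q v) \<and>
     (\<forall>c. \<forall>u\<in>fin_space \<Omega> J. q (\<lambda>x. c * u x) = c * q u) \<and>
     (\<exists>C. \<forall>u\<in>fin_space \<Omega> J. ereal \<bar>q u\<bar> \<le> ereal C * J u)}"

definition fin_separable :: "(real ^ 'm::finite) set \<Rightarrow> ('m func \<Rightarrow> ereal) \<Rightarrow> bool" where
  "fin_separable \<Omega> J \<longleftrightarrow> (\<exists>D. countable D \<and> D \<subseteq> fin_space \<Omega> J \<and>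
     (\<forall>u\<in>fin_space \<Omega> J. \<forall>e>0. \<exists>d\<in>D. J (\<lambda>x. u x - d x) < ereal e))"

definition subdiff :: "(real ^ 'm::finite) set \<Rightarrow> ('m func \<Rightarrow> ereal) \<Rightarrow> 'm func \<Rightarrow> 'm func set" where
  "subdiff \<Omega> J u = {p \<in> Linf \<Omega>.
     (\<forall>v\<in>L1 \<Omega>. ereal (pairing \<Omega> p v) \<le> J v) \<and> J u = ereal (pairing \<Omega> p u)}"

definition fin_subdiff :: "(real ^ 'm::finite) set \<Rightarrow> ('m func \<Rightarrow> ereal) \<Rightarrow> 'm func \<Rightarrow> 'm functional set" where
  "fin_subdiff \<Omega> J u = {q \<in> fin_dual \<Omega> J.
     (\<forall>v\<in>fin_space \<Omega> J. ereal (q v) \<le> J v) \<and> J u = ereal (q u)}"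

text \<open>Weak-* convergence, along a filter \<open>F\<close> on the indices, of $L^\infty$ functions regarded as
  elements of the dual of $(\mathcal V, \mathcal J)$.\<close>

definition weak_star_lim ::
  "(real ^ 'm::finite) set \<Rightarrow> ('m func \<Rightarrow> ereal) \<Rightarrow> (nat \<Rightarrow> 'm func) \<Rightarrow> 'm functional \<Rightarrow> nat filter \<Rightarrow> bool" where
  "weak_star_lim \<Omega> J p q F \<longleftrightarrow> q \<in> fin_dual \<Omega> J \<and>
     (\<forall>v\<in>fin_space \<Omega> J. ((\<lambda>n. pairing \<Omega> (p n) v) \<longlongrightarrow> q v) F)"

text \<open>The unit ball of the dual of $(\mathcal V, \mathcal J)$ is always weak-* compact, but for
  non-separable $\mathcal V$ (for instance $\mathcal V = BV$) it need not be weak-* sequentially compact.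
  Subsequences are therefore generalised subsequences (subnets of the sequence, encoded as proper
  filters finer than \<^term>\<open>sequentially\<close>), required to be ordinary subsequences whenever
  $\mathcal V$ is separable.\<close>

definition subsequence_filter :: "(real ^ 'm::finite) set \<Rightarrow> ('m func \<Rightarrow> ereal) \<Rightarrow> nat filter \<Rightarrow> bool" where
  "subsequence_filter \<Omega> J F \<longleftrightarrow> F \<noteq> bot \<and> F \<le> sequentially \<and>
     (fin_separable \<Omega> J \<longrightarrow> (\<exists>r. strict_mono r \<and> F = filtermap r sequentially))"


subsection \<open>Problem, assumptions and dual problem\<close>

definition nonneg_solution ::
  "(real ^ 'm::finite) set \<Rightarrow> ('m func \<Rightarrow> 'm func) \<Rightarrow> 'm func \<Rightarrow> 'm func \<Rightarrow> bool" where
  "nonneg_solution \<Omega> A f u \<longleftrightarrow> u \<in> L1 \<Omega> \<and> ae_nonneg \<Omega> u \<and> ae_eq \<Omega> (A u) f"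

definition J_minimising ::
  "(real ^ 'm::finite) set \<Rightarrow> ('m func \<Rightarrow> ereal) \<Rightarrow> ('m func \<Rightarrow> 'm func) \<Rightarrow> 'm func \<Rightarrow> 'm func \<Rightarrow> bool" where
  "J_minimising \<Omega> J A f u \<longleftrightarrow>
     nonneg_solution \<Omega> A f u \<and> (\<forall>v. nonneg_solution \<Omega> A f v \<longrightarrow> J u \<le> J v)"

definition data_bounds ::
  "(real ^ 'm::finite) set \<Rightarrow> 'm func \<Rightarrow> (nat \<Rightarrow> 'm func) \<Rightarrow> (nat \<Rightarrow> 'm func) \<Rightarrow> bool" where
  "data_bounds \<Omega> f fl fu \<longleftrightarrow>
     f \<in> Linf \<Omega> \<and> (\<forall>n. fl n \<in> Linf \<Omega> \<and> fu n \<in> Linf \<Omega>) \<and>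
     (\<forall>n. ae_le \<Omega> (fl n) f \<and> ae_le \<Omega> f (fu n)) \<and>
     (\<forall>n. ae_le \<Omega> (fl n) (fl (Suc n)) \<and> ae_le \<Omega> (fu (Suc n)) (fu n)) \<and>
     (\<lambda>n. linf_norm \<Omega> (\<lambda>x. fu n x - fl n x)) \<longlonglongrightarrow> 0"

definition operator_bounds ::
  "(real ^ 'm::finite) set \<Rightarrow> ('m func \<Rightarrow> 'm func) \<Rightarrow> (nat \<Rightarrow> 'm func \<Rightarrow> 'm func) \<Rightarrow>
   (nat \<Rightarrow> 'm func \<Rightarrow> 'm func) \<Rightarrow> bool" where
  "operator_bounds \<Omega> A Al Au \<longleftrightarrow>
     linear_op \<Omega> A \<and> (\<forall>n. regular_op \<Omega> (Al n) \<and> regular_op \<Omega> (Au n)) \<and>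
     (\<forall>n. op_le \<Omega> (Al n) A \<and> op_le \<Omega> A (Au n)) \<and>
     (\<forall>n. op_le \<Omega> (Al n) (Al (Suc n)) \<and> op_le \<Omega> (Au (Suc n)) (Au n)) \<and>
     (\<lambda>n. op_norm \<Omega> (linf_norm \<Omega>) (\<lambda>u x. Au n u x - Al n u x)) \<longlonglongrightarrow> 0"

definition convergence_assumption ::
  "(real ^ 'm::finite) set \<Rightarrow> (nat \<Rightarrow> 'm func \<Rightarrow> 'm func \<times> 'm func) \<Rightarrow> ('m func \<Rightarrow> 'm func \<times> 'm func) \<Rightarrow>
   (nat \<Rightarrow> 'm func \<times> 'm func) \<Rightarrow> 'm func \<times> 'm func \<Rightarrow> bool" where
  "convergence_assumption \<Omega> B Bbar \<phi> \<phi>bar \<longleftrightarrow>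
     (\<exists>(\<epsilon>::nat \<Rightarrow> real) (\<eta>::nat \<Rightarrow> real) (C0::real) (D0::real).
        (\<forall>n. 0 < \<epsilon> n) \<and> decseq \<epsilon> \<and> \<epsilon> \<longlonglongrightarrow> 0 \<and> decseq \<eta> \<and> \<eta> \<longlonglongrightarrow> 0 \<and> 1 \<le> C0 \<and> 0 < D0 \<and>
        (\<forall>n. let d = pair_diff (\<phi> n) \<phi>bar in
             ae_le \<Omega> (\<lambda>_. \<epsilon> n) (fst d) \<and> ae_le \<Omega> (fst d) (\<lambda>_. C0 * \<epsilon> n) \<and>
             ae_le \<Omega> (\<lambda>_. \<epsilon> n) (snd d) \<and> ae_le \<Omega> (snd d) (\<lambda>_. C0 * \<epsilon> n)) \<and>
        (\<forall>n. op_norm \<Omega> (linf_norm2 \<Omega>) (\<lambda>u. pair_diff (Bbar u) (B n u)) \<le> ereal (\<eta> n)) \<and>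
        limsup (\<lambda>n. ereal (\<eta> n / \<epsilon> n)) \<le> ereal D0)"

definition source_condition ::
  "(real ^ 'm::finite) set \<Rightarrow> ('m func \<Rightarrow> ereal) \<Rightarrow> ('m func \<Rightarrow> 'm func \<times> 'm func) \<Rightarrow> 'm func \<Rightarrow> bool" where
  "source_condition \<Omega> J Bbar u \<longleftrightarrow>
     (\<exists>\<mu>. nonneg_multiplier \<Omega> \<mu> \<and> (\<lambda>x. - adjoint_op \<Omega> Bbar \<mu> x) \<in> subdiff \<Omega> J u)"

definition nonempty_interior_assumption ::
  "(real ^ 'm::finite) set \<Rightarrow> ('m func \<Rightarrow> ereal) \<Rightarrow> bool" where
  "nonempty_interior_assumption \<Omega> J \<longleftrightarrow>
     (\<exists>r>0. \<forall>g\<in>Linf \<Omega>. linf_norm \<Omega> g < ereal r \<longrightarrow> g \<in> subdiff \<Omega> J (\<lambda>_. 0))"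

definition dual_variable ::
  "(real ^ 'm::finite) set \<Rightarrow> ('m func \<Rightarrow> 'm func \<times> 'm func) \<Rightarrow>
   'm func \<Rightarrow> 'm functional \<times> 'm functional \<Rightarrow> 'm func" where
  "dual_variable \<Omega> B lam \<mu> = (\<lambda>x. lam x - adjoint_op \<Omega> B \<mu> x)"

definition dual_feasible ::
  "(real ^ 'm::finite) set \<Rightarrow> ('m func \<Rightarrow> ereal) \<Rightarrow> ('m func \<Rightarrow> 'm func \<times> 'm func) \<Rightarrow>
   'm func \<Rightarrow> 'm functional \<times> 'm functional \<Rightarrow> bool" where
  "dual_feasible \<Omega> J B lam \<mu> \<longleftrightarrow>
     lam \<in> Linf \<Omega> \<and> ae_nonneg \<Omega> lam \<and> nonneg_multiplier \<Omega> \<mu> \<and>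
     dual_variable \<Omega> B lam \<mu> \<in> subdiff \<Omega> J (\<lambda>_. 0)"

definition dual_solution ::
  "(real ^ 'm::finite) set \<Rightarrow> ('m func \<Rightarrow> ereal) \<Rightarrow> ('m func \<Rightarrow> 'm func \<times> 'm func) \<Rightarrow>
   'm func \<times> 'm func \<Rightarrow> 'm func \<Rightarrow> 'm functional \<times> 'm functional \<Rightarrow> bool" where
  "dual_solution \<Omega> J B \<phi> lam \<mu> \<longleftrightarrow>
     dual_feasible \<Omega> J B lam \<mu> \<and>
     (\<forall>lam' \<mu>'. dual_feasible \<Omega> J B lam' \<mu>' \<longrightarrow>
        dpairing \<mu>' (pair_neg \<phi>) \<le> dpairing \<mu> (pair_neg \<phi>))"

end

theory Submission
  imports Defs
begin

text \<open>The proof compares the value of the dual problem at its maximiser with its value at a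
  competitor built from the source condition.

  Let $\nu\geq 0$ be a multiplier for the source condition, let $|\mu| = (\mu,\mathbf 1)$ denote the
  norm of a non-negative multiplier, and let $c>0$ satisfy $c\,\|v\|_1 \leq \mathcal J(v)$; such a
  $c$ is what the interior assumption provides (\<open>interior_coercive\<close>). The pair $(0,\nu)$
  satisfies the dual constraint for $\bar B$, but for $B_n$ only up to an error of size
  $|\nu|\eta_n$ in $L^\infty$, that is, up to the fraction $t_n = |\nu|\eta_n/c$ of $\mathcal J$.
  Hence $(0,(1-t_n)\nu)$ is feasible, where $t_n$ is cut off at $1$
  (\<open>dual_feasible_shrunk_source\<close>). Testing optimality of $(\lambda_n,\mu_n)$ against it and using
  $\phi_n-\bar\phi\geq\varepsilon_n\mathbf 1$ and $B_n u\leq\bar B u$ for $u\geq 0$ gives, for each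
  $\mathcal J$-minimising solution $u$,
  \[ \varepsilon_n|\mu_n| + (\lambda_n,u) + \bigl(\mathcal J(u)-(p_n,u)\bigr)
     \leq \frac{|\nu|\,\eta_n}{c}\,\mathcal J(u) + C_0\,\varepsilon_n|\nu| \]
  (\<open>dual_optimality_estimate\<close>). The right-hand side is $O(\varepsilon_n)$ and all summands on the
  left are non-negative. So $|\mu_n|$ stays bounded, while $(\lambda_n,u)\to 0$ and
  $(p_n,u)\to\mathcal J(u)$.

  Since $p_n\in\partial\mathcal J(0)$, the sequence $p_n$ lies in the unit ball of $\mathcal V^*$; and
  $\lambda_n = p_n + B_n^*\mu_n$ is bounded in $\mathcal V^*$ because $|\mu_n|$ and $\|B_n\|$ are
  bounded and $\|v\|_1\leq\mathcal J(v)/c$. The Banach--Alaoglu theorem yields a common limit filter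
  for both sequences (\<open>weak_star_compactness\<close>), and the claims follow by passing to the limit.

  Two facts on $L^1$ are needed along the way. The adjoints act as claimed only if the functional
  $u\mapsto(\mu,Bu)$ is represented by an $L^\infty$ function, which is the duality
  $(L^1)^*=L^\infty$ (\<open>L1_functional_representation\<close>). That duality requires the functional to be
  continuous, which comes from the automatic continuity of positive operators
  (\<open>monotone_functional_bounded\<close>).\<close>

section \<open>Continuity and representation of functionals on the space of integrable functions\<close>

text \<open>A gliding hump: if no constant works, there are normalised $w_k\geq0$ with integral $2^{-k}$
  and $N(w_k)>2^k$. Their sum is integrable and dominates every $w_k$, so monotonicity would make
  its image exceed every $2^k$.\<close>
lemma monotone_functional_bounded:
  fixes N :: "('a \<Rightarrow> real) \<Rightarrow> real"
  assumes mono: "\<And>u v. integrable M u \<Longrightarrow> integrable M v \<Longrightarrow> AE x in M. 0 \<le> u x \<Longrightarrow> AE x in M. u x \<le> v x \<Longrightarrow> N u \<le> N v"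
    and homog: "\<And>c u. 0 < c \<Longrightarrow> integrable M u \<Longrightarrow> AE x in M. 0 \<le> u x \<Longrightarrow> N (\<lambda>x. c * u x) = c * N u"
  shows "\<exists>C\<ge>0. \<forall>u. integrable M u \<longrightarrow> (AE x in M. 0 \<le> u x) \<longrightarrow> N u \<le> C * (LINT x|M. u x)"
proof (rule ccontr)
  assume neg: "\<not> ?thesis"
  have "\<exists>u. integrable M u \<and> (AE x in M. 0 \<le> u x) \<and> N u > 4 ^ k * (LINT x|M. u x)" for k :: nat
  proof -
    have "(4 :: real) ^ k \<ge> 0" by simp
    then show ?thesis using neg not_le by blast
  qed
  then obtain u where int: "\<And>k. integrable M (u k)" and pos: "\<And>k. AE x in M. 0 \<le> u k x"
    and big: "\<And>k::nat. N (u k) > 4 ^ k * (LINT x|M. u k x)"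
    by metis
  have N0: "N (\<lambda>_. 0) = 0"
    using homog[of 2 "\<lambda>_. 0"] by simp
  have I: "(LINT x|M. u k x) > 0" for k
  proof (rule ccontr)
    assume "\<not> ?thesis"
    moreover have "(LINT x|M. u k x) \<ge> 0" using pos by (rule integral_nonneg_AE)
    ultimately have z: "(LINT x|M. u k x) = 0" by simp
    then have "AE x in M. u k x = 0"
      using integral_nonneg_eq_0_iff_AE[OF int pos] by blast
    then have "N (u k) \<le> N (\<lambda>_. 0)"
      by (intro mono[OF int _ pos]) auto
    with N0 big[of k] z show False by simp
  qed
  \<comment> \<open>The factor \<open>4 ^ k\<close> above leaves \<open>2 ^ k\<close> after dividing by \<open>2 ^ k\<close> for summability.\<close>
  define w where "w k x = u k x / (2 ^ k * (LINT x|M. u k x))" for k x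
  have w_int: "integrable M (w k)" for k
    unfolding w_def using int by simp
  have w_pos: "AE x in M. 0 \<le> w k x" for k
    using pos[of k] I[of k] unfolding w_def by (auto simp: less_imp_le)
  have w_big: "N (w k) > 2 ^ k" for k
  proof -
    have "N (w k) = N (\<lambda>x. (1 / (2 ^ k * (LINT x|M. u k x))) * u k x)"
      unfolding w_def by (simp add: mult.commute)
    also have "\<dots> = (1 / (2 ^ k * (LINT x|M. u k x))) * N (u k)"
      using I[of k] int pos by (intro homog) auto
    finally have "N (w k) = N (u k) / (2 ^ k * (LINT x|M. u k x))" by simp
    moreover have "4 ^ k = 2 ^ k * (2::real) ^ k"
      by (simp add: power_mult_distrib[symmetric])
    ultimately show ?thesis
      using big[of k] I[of k] by (simp add: pos_less_divide_eq mult.assoc)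
  qed
  have w_nn: "(\<integral>\<^sup>+x. ennreal (w k x) \<partial>M) = ennreal ((1/2) ^ k)" for k
  proof -
    have "(LINT x|M. w k x) = (1/2) ^ k"
      using I[of k] unfolding w_def by (simp add: power_one_over)
    then show ?thesis using nn_integral_eq_integral[OF w_int w_pos] by simp
  qed
  have [measurable]: "w k \<in> borel_measurable M" for k
    using w_int by (rule borel_measurable_integrable)
  define W where "W x = (\<Sum>k. ennreal (w k x))" for x
  have [measurable]: "W \<in> borel_measurable M" unfolding W_def by measurable
  have "(\<integral>\<^sup>+x. W x \<partial>M) = (\<Sum>k. ennreal ((1/2) ^ k))"
    unfolding W_def by (simp add: nn_integral_suminf w_nn)
  also have "\<dots> = ennreal (\<Sum>k. (1/2) ^ k)"
    by (intro suminf_ennreal2) (auto intro: summable_geometric)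
  finally have W_fin: "(\<integral>\<^sup>+x. W x \<partial>M) < \<infinity>" by simp
  then have W_AE: "AE x in M. W x < \<infinity>"
    using nn_integral_PInf_AE[of W M] by (simp add: less_top)
  have W_int: "integrable M (\<lambda>x. enn2real (W x))"
  proof (rule integrableI_bounded)
    have "(\<integral>\<^sup>+x. ennreal (norm (enn2real (W x))) \<partial>M) = (\<integral>\<^sup>+x. W x \<partial>M)"
      using W_AE by (intro nn_integral_cong_AE) auto
    then show "(\<integral>\<^sup>+x. ennreal (norm (enn2real (W x))) \<partial>M) < \<infinity>" using W_fin by simp
  qed simp
  have "AE x in M. w k x \<le> enn2real (W x)" for k
    using W_AE
  proof eventually_elim
    case (elim x)
    have "ennreal (w k x) \<le> W x"
      unfolding W_def using sum_le_suminf[of "\<lambda>k. ennreal (w k x)" "{k}"] by simp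
    then show ?case using elim
      by (metis enn2real_mono enn2real_nonneg ennreal_enn2real ennreal_le_iff infinity_ennreal_def)
  qed
  then have "N (w k) \<le> N (\<lambda>x. enn2real (W x))" for k
    by (intro mono w_int W_int w_pos)
  then have "2 ^ k < N (\<lambda>x. enn2real (W x))" for k
    using w_big[of k] by (meson less_le_trans)
  moreover obtain k where "N (\<lambda>x. enn2real (W x)) < 2 ^ k"
    using real_arch_pow[of 2 "N (\<lambda>x. enn2real (W x))"] by auto
  ultimately show False by (metis less_asym)
qed

text \<open>The duality $(L^1)^*=L^\infty$. The functional $l + K\int$ is positive for $K=|C|$ and
  dominated by $2K\int$. On indicator functions it is therefore a finite measure with a
  Radon--Nikodym density $g\leq 2K$, and $q = g-K$ represents $l$.\<close>
lemma (in finite_measure) L1_functional_representation: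
  fixes l :: "('a \<Rightarrow> real) \<Rightarrow> real"
  assumes add: "\<And>u v. integrable M u \<Longrightarrow> integrable M v \<Longrightarrow> l (\<lambda>x. u x + v x) = l u + l v"
    and scale: "\<And>c u. integrable M u \<Longrightarrow> l (\<lambda>x. c * u x) = c * l u"
    and bound: "\<And>u. integrable M u \<Longrightarrow> \<bar>l u\<bar> \<le> C * (LINT x|M. \<bar>u x\<bar>)"
  shows "\<exists>q\<in>borel_measurable M. (\<exists>K. AE x in M. \<bar>q x\<bar> \<le> K) \<and>
           (\<forall>u. integrable M u \<longrightarrow> (LINT x|M. q x * u x) = l u)"
proof -
  define K where "K = \<bar>C\<bar>"
  have K0: "0 \<le> K" by (simp add: K_def)
  have bd: "\<bar>l u\<bar> \<le> K * (LINT x|M. \<bar>u x\<bar>)" if "integrable M u" for u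
  proof -
    have "C * (LINT x|M. \<bar>u x\<bar>) \<le> K * (LINT x|M. \<bar>u x\<bar>)"
      unfolding K_def by (intro mult_right_mono) auto
    then show ?thesis using bound[OF that] by linarith
  qed
  have [simp]: "integrable M (indicat_real E)" if "E \<in> sets M" for E
    using that by (simp add: less_top[symmetric])
  have ind: "\<bar>l (indicat_real E)\<bar> \<le> K * measure M E" if "E \<in> sets M" for E
    using bd[of "indicat_real E"] that by simp
  define \<nu> where "\<nu> E = ennreal (l (indicat_real E) + K * measure M E)" for E
  have \<nu>_le: "\<nu> E \<le> ennreal (2 * K) * emeasure M E" if "E \<in> sets M" for E
    unfolding \<nu>_def emeasure_eq_measure using ind[OF that] K0
    by (simp flip: ennreal_mult)
  have l0: "l (indicat_real {}) = 0"
    using ind[of "{}"] by simp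
  have "countably_additive (sets M) \<nu>"
  proof (rule sets.empty_continuous_imp_countably_additive)
    show "positive (sets M) \<nu>"
      unfolding positive_def \<nu>_def by (simp add: l0)
    show "additive (sets M) \<nu>"
      unfolding additive_def
    proof safe
      fix E F assume E: "E \<in> sets M" and F: "F \<in> sets M" and d: "E \<inter> F = {}"
      have "indicat_real (E \<union> F) = (\<lambda>x. indicat_real E x + indicat_real F x)"
        using d by (auto simp: indicator_def fun_eq_iff)
      then have "l (indicat_real (E \<union> F)) = l (indicat_real E) + l (indicat_real F)"
        using add[of "indicat_real E" "indicat_real F"] E F by simp
      moreover have "measure M (E \<union> F) = measure M E + measure M F"
        using E F d by (simp add: finite_measure_Union)
      ultimately show "\<nu> (E \<union> F) = \<nu> E + \<nu> F"
        unfolding \<nu>_def using ind[OF E] ind[OF F]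
        by (subst ennreal_plus[symmetric]) (auto simp: algebra_simps)
    qed
    show "\<forall>A\<in>sets M. \<nu> A \<noteq> \<infinity>" by (simp add: \<nu>_def)
    \<comment> \<open>Countable additivity is continuity at the empty set, inherited from \<open>M\<close> by domination.\<close>
    show "(\<lambda>i. \<nu> (E i)) \<longlonglongrightarrow> 0" if E: "range E \<subseteq> sets M" "decseq E" "(\<Inter>i. E i) = {}" for E
    proof (rule tendsto_sandwich[OF _ _ tendsto_const])
      have "(\<lambda>i. measure M (E i)) \<longlonglongrightarrow> measure M (\<Inter>i. E i)"
        using E by (intro finite_Lim_measure_decseq) auto
      then have "(\<lambda>i. 2 * K * measure M (E i)) \<longlonglongrightarrow> 2 * K * 0"
        using E(3) by (intro tendsto_mult tendsto_const) simp
      then have "(\<lambda>i. ennreal (2 * K * measure M (E i))) \<longlonglongrightarrow> ennreal (2 * K * 0)"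
        by (rule tendsto_ennrealI)
      then show "(\<lambda>i. ennreal (2 * K) * emeasure M (E i)) \<longlonglongrightarrow> 0"
        using K0 by (simp add: emeasure_eq_measure ennreal_mult)
      show "\<forall>\<^sub>F i in sequentially. \<nu> (E i) \<le> ennreal (2 * K) * emeasure M (E i)"
        using E(1) \<nu>_le by (intro always_eventually) auto
    qed simp
  qed
  then have N: "emeasure (measure_of (space M) (sets M) \<nu>) E = \<nu> E" if "E \<in> sets M" for E
    using that
    by (intro emeasure_measure_of_sigma sets.sigma_algebra_axioms)
       (auto simp: positive_def \<nu>_def l0)
  define N where "N = measure_of (space M) (sets M) \<nu>"
  have sN: "sets N = sets M" unfolding N_def by simp
  have "absolutely_continuous M N"
    unfolding absolutely_continuous_def
  proof (rule subsetI)
    fix E assume E: "E \<in> null_sets M"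
    then have "emeasure N E \<le> ennreal (2 * K) * emeasure M E"
      unfolding N_def by (subst N) (auto intro!: \<nu>_le)
    with E sN show "E \<in> null_sets N" by (auto simp: null_sets_def)
  qed
  from Radon_Nikodym[OF this sN] obtain g where g[measurable]: "g \<in> borel_measurable M"
    and dg: "density M g = N" by blast
  have g_int: "(\<integral>\<^sup>+x. g x * indicator E x \<partial>M) = \<nu> E" if "E \<in> sets M" for E
    using that N[OF that] by (simp add: emeasure_density[symmetric] dg N_def)
  have g_le: "AE x in M. g x \<le> ennreal (2 * K)"
  proof -
    define E where "E = {x \<in> space M. g x > ennreal (2 * K)}"
    have E[measurable]: "E \<in> sets M" unfolding E_def by measurable
    have eq: "(\<integral>\<^sup>+x. ennreal (2 * K) * indicator E x \<partial>M) = ennreal (2 * K) * emeasure M E"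
      by (simp add: nn_integral_cmult_indicator)
    have "AE x in M. \<not> x \<in> E"
    proof (rule ccontr)
      assume ne: "\<not> ?thesis"
      have "(\<integral>\<^sup>+x. ennreal (2 * K) * indicator E x \<partial>M) < (\<integral>\<^sup>+x. g x * indicator E x \<partial>M)"
      proof (rule nn_integral_less)
        show "(\<integral>\<^sup>+x. ennreal (2 * K) * indicator E x \<partial>M) \<noteq> \<infinity>"
          unfolding eq by (simp add: emeasure_eq_measure ennreal_mult[symmetric] K0)
        show "AE x in M. ennreal (2 * K) * indicator E x \<le> g x * indicator E x"
          by (auto simp: E_def indicator_def)
        show "\<not> (AE x in M. g x * indicator E x \<le> ennreal (2 * K) * indicator E x)"
        proof
          assume "AE x in M. g x * indicator E x \<le> ennreal (2 * K) * indicator E x"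
          then have "AE x in M. \<not> x \<in> E"
            by eventually_elim (auto simp: E_def indicator_def split: if_splits)
          with ne show False by simp
        qed
      qed simp_all
      then show False using g_int[OF E] \<nu>_le[OF E] eq by simp
    qed
    with AE_space show ?thesis
      by eventually_elim (auto simp: E_def not_less)
  qed
  define q where "q x = enn2real (g x) - K" for x
  have q[measurable]: "q \<in> borel_measurable M" unfolding q_def by measurable
  have q_bd: "AE x in M. \<bar>q x\<bar> \<le> K"
    using g_le
  proof eventually_elim
    case (elim x)
    then have "enn2real (g x) \<le> 2 * K"
      using K0 by (simp add: enn2real_leI)
    then show ?case unfolding q_def using enn2real_nonneg[of "g x"] by (simp add: abs_le_iff)
  qed
  have qi: "integrable M (\<lambda>x. q x * u x)" if u: "integrable M u" for u
  proof (rule Bochner_Integration.integrable_bound)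
    show "integrable M (\<lambda>x. K * u x)" using u by simp
    show "(\<lambda>x. q x * u x) \<in> borel_measurable M" using u by simp
    show "AE x in M. norm (q x * u x) \<le> norm (K * u x)"
      using q_bd by eventually_elim (use K0 in \<open>auto simp: abs_mult intro!: mult_right_mono\<close>)
  qed
  have "(LINT x|M. q x * u x) = l u" if "integrable M u" for u
    using that
  proof (induction rule: integrable_induct)
    case (base E c)
    have gi: "integrable M (\<lambda>x. enn2real (g x) * indicat_real E x)"
      and "(LINT x|M. enn2real (g x) * indicat_real E x) = l (indicat_real E) + K * measure M E"
    proof -
      have "(\<integral>\<^sup>+x. ennreal (enn2real (g x) * indicat_real E x) \<partial>M) = (\<integral>\<^sup>+x. g x * indicator E x \<partial>M)"
        using g_le
        by (intro nn_integral_cong_AE, eventually_elim)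
           (auto simp: indicator_def ennreal_enn2real_if top_unique)
      then have n: "(\<integral>\<^sup>+x. ennreal (enn2real (g x) * indicat_real E x) \<partial>M)
          = ennreal (l (indicat_real E) + K * measure M E)"
        using g_int[OF base(1)] by (simp add: \<nu>_def)
      show "integrable M (\<lambda>x. enn2real (g x) * indicat_real E x)"
        using n base(1) by (intro integrableI_nonneg) auto
      show "(LINT x|M. enn2real (g x) * indicat_real E x) = l (indicat_real E) + K * measure M E"
        using n base(1) ind[OF base(1)]
        by (subst integral_eq_nn_integral) (auto simp: K0 intro!: enn2real_ennreal)
    qed
    then have "(LINT x|M. q x * indicat_real E x) = l (indicat_real E)"
      using base(1) by (simp add: q_def left_diff_distrib)
    then show ?case
      using scale[of "indicat_real E" c] base(1)
      by (simp add: mult.commute[of _ c] mult.left_commute[of _ c])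
  next
    case (add u v)
    then show ?case
      using assms(1)[of u v] qi[of u] qi[of v] by (simp add: distrib_left)
  next
    case (lim u s)
    have dl: "\<bar>(LINT x|M. q x * u x) - l u\<bar> \<le> 2 * K * (LINT x|M. \<bar>s i x - u x\<bar>)" for i
    proof -
      have d: "integrable M (\<lambda>x. s i x - u x)" using lim by simp
      have "l (\<lambda>x. (s i x - u x) + u x) = l (\<lambda>x. s i x - u x) + l u"
        by (rule assms(1)[OF d lim.hyps(4)])
      then have a: "l (s i) - l u = l (\<lambda>x. s i x - u x)" by simp
      have b: "(LINT x|M. q x * s i x) - (LINT x|M. q x * u x) = (LINT x|M. q x * (s i x - u x))"
        using qi[OF lim.hyps(1)] qi[OF lim.hyps(4)] by (simp add: right_diff_distrib)
      have "\<bar>LINT x|M. q x * (s i x - u x)\<bar> \<le> (LINT x|M. \<bar>q x * (s i x - u x)\<bar>)"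
        by (rule integral_abs_bound)
      also have "\<dots> \<le> (LINT x|M. K * \<bar>s i x - u x\<bar>)"
      proof (rule integral_mono_AE)
        show "AE x in M. \<bar>q x * (s i x - u x)\<bar> \<le> K * \<bar>s i x - u x\<bar>"
          using q_bd by eventually_elim (simp add: abs_mult mult_right_mono)
      qed (use qi[OF d] d in auto)
      finally have "\<bar>LINT x|M. q x * (s i x - u x)\<bar> \<le> K * (LINT x|M. \<bar>s i x - u x\<bar>)" by simp
      with a b bd[OF d] lim.IH[of i] show ?thesis by (simp add: abs_le_iff)
    qed
    have "(\<lambda>i. LINT x|M. \<bar>s i x - u x\<bar>) \<longlonglongrightarrow> (LINT x|M. 0)"
    proof (rule integral_dominated_convergence[where w="\<lambda>x. 3 * \<bar>u x\<bar>"])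
      show "AE x in M. (\<lambda>i. \<bar>s i x - u x\<bar>) \<longlonglongrightarrow> 0"
        using lim.hyps(2) by (intro AE_I2 tendsto_rabs_zero) (simp add: LIM_zero)
      show "AE x in M. norm \<bar>s i x - u x\<bar> \<le> 3 * \<bar>u x\<bar>" for i
        using lim.hyps(3)[of _ i] by (intro AE_I2) (fastforce simp: abs_le_iff)
    qed (use lim in auto)
    then have "(\<lambda>i. 2 * K * (LINT x|M. \<bar>s i x - u x\<bar>)) \<longlonglongrightarrow> 0"
      by (intro tendsto_mult_right_zero) simp
    then have "\<bar>(LINT x|M. q x * u x) - l u\<bar> \<le> 0"
      by (rule LIMSEQ_le_const) (use dl in blast)
    then show ?case by simp
  qed
  with q q_bd show ?thesis by blast
qed

section \<open>Essentially bounded functions and the pairing\<close>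

lemma finite_measure_domain:
  assumes "bounded_domain \<Omega>" shows "finite_measure (lebesgue_on \<Omega>)"
  using assms unfolding bounded_domain_def
  by (intro finite_measure_lebesgue_on lmeasurable_open) auto

lemma domain_measure_nonzero:
  assumes "bounded_domain \<Omega>" shows "emeasure (lebesgue_on \<Omega>) (space (lebesgue_on \<Omega>)) \<noteq> 0"
proof -
  have "open \<Omega>" "\<Omega> \<noteq> {}" using assms unfolding bounded_domain_def by auto
  then have "\<Omega> \<in> sets lebesgue" "\<Omega> \<notin> null_sets lebesgue"
    using open_not_negligible[of \<Omega>] by (auto simp: negligible_iff_null_sets)
  then show ?thesis
    by (auto simp: emeasure_restrict_space null_sets_def)
qed

lemma linf_norm_le_iff:
  assumes "g \<in> borel_measurable (lebesgue_on \<Omega>)"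
  shows "linf_norm \<Omega> g \<le> ereal K \<longleftrightarrow> (AE x in lebesgue_on \<Omega>. \<bar>g x\<bar> \<le> K)"
proof
  assume le: "linf_norm \<Omega> g \<le> ereal K"
  have "AE x in lebesgue_on \<Omega>. ereal \<bar>g x\<bar> \<le> linf_norm \<Omega> g"
    unfolding linf_norm_def by (rule esssup_AE)
  then show "AE x in lebesgue_on \<Omega>. \<bar>g x\<bar> \<le> K"
  proof eventually_elim
    case (elim x)
    with le have "ereal \<bar>g x\<bar> \<le> ereal K" by (rule order_trans[rotated])
    then show ?case by simp
  qed
qed (use assms in \<open>auto simp: linf_norm_def intro!: esssup_I\<close>)

text \<open>On a null set every essential supremum is $-\infty$, so the domain has to have positive
  measure for this.\<close>
lemma linf_norm_nonneg:
  assumes "bounded_domain \<Omega>" "g \<in> borel_measurable (lebesgue_on \<Omega>)"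
  shows "0 \<le> linf_norm \<Omega> g"
proof -
  have "esssup (lebesgue_on \<Omega>) (\<lambda>_. 0::ereal) \<le> linf_norm \<Omega> g"
    unfolding linf_norm_def by (rule esssup_mono) auto
  then show ?thesis
    using esssup_const[OF domain_measure_nonzero[OF assms(1)], of "0::ereal"] by simp
qed

lemma Linf_iff:
  "g \<in> Linf \<Omega> \<longleftrightarrow> g \<in> borel_measurable (lebesgue_on \<Omega>) \<and> (\<exists>K. AE x in lebesgue_on \<Omega>. \<bar>g x\<bar> \<le> K)"
proof (cases "g \<in> borel_measurable (lebesgue_on \<Omega>)")
  case True
  have "linf_norm \<Omega> g < \<infinity> \<longleftrightarrow> (\<exists>K. linf_norm \<Omega> g \<le> ereal K)"
    by (cases "linf_norm \<Omega> g") auto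
  with True show ?thesis by (simp add: Linf_def linf_norm_le_iff)
qed (simp add: Linf_def)

lemma Linf_measurable: "g \<in> Linf \<Omega> \<Longrightarrow> g \<in> borel_measurable (lebesgue_on \<Omega>)"
  by (simp add: Linf_def)

lemma LinfI:
  "g \<in> borel_measurable (lebesgue_on \<Omega>) \<Longrightarrow> AE x in lebesgue_on \<Omega>. \<bar>g x\<bar> \<le> K \<Longrightarrow> g \<in> Linf \<Omega>"
  by (auto simp: Linf_iff)

lemma Linf_const [simp]: "(\<lambda>_. c) \<in> Linf \<Omega>"
  by (rule LinfI[where K="\<bar>c\<bar>"]) auto

lemma Linf_add:
  assumes "g \<in> Linf \<Omega>" "h \<in> Linf \<Omega>" shows "(\<lambda>x. g x + h x) \<in> Linf \<Omega>"
proof -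
  obtain K where "AE x in lebesgue_on \<Omega>. \<bar>g x\<bar> \<le> K" using assms(1) by (auto simp: Linf_iff)
  moreover obtain L where "AE x in lebesgue_on \<Omega>. \<bar>h x\<bar> \<le> L" using assms(2) by (auto simp: Linf_iff)
  ultimately have "AE x in lebesgue_on \<Omega>. \<bar>g x + h x\<bar> \<le> K + L"
    by eventually_elim auto
  then show ?thesis using assms[THEN Linf_measurable] by (intro LinfI[where K="K + L"]) simp_all
qed

lemma Linf_cmult:
  assumes "g \<in> Linf \<Omega>" shows "(\<lambda>x. c * g x) \<in> Linf \<Omega>"
proof -
  obtain K where "AE x in lebesgue_on \<Omega>. \<bar>g x\<bar> \<le> K" using assms by (auto simp: Linf_iff)
  then have "AE x in lebesgue_on \<Omega>. \<bar>c * g x\<bar> \<le> \<bar>c\<bar> * K"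
    by eventually_elim (auto simp: abs_mult mult_left_mono)
  then show ?thesis using assms[THEN Linf_measurable] by (intro LinfI[where K="\<bar>c\<bar> * K"]) simp_all
qed

lemma Linf_uminus: "g \<in> Linf \<Omega> \<Longrightarrow> (\<lambda>x. - g x) \<in> Linf \<Omega>"
  using Linf_cmult[of g \<Omega> "-1"] by simp

lemma Linf_diff: "g \<in> Linf \<Omega> \<Longrightarrow> h \<in> Linf \<Omega> \<Longrightarrow> (\<lambda>x. g x - h x) \<in> Linf \<Omega>"
  using Linf_add[OF _ Linf_uminus] by fastforce

lemma L1_add: "u \<in> L1 \<Omega> \<Longrightarrow> v \<in> L1 \<Omega> \<Longrightarrow> (\<lambda>x. u x + v x) \<in> L1 \<Omega>"
  and L1_diff: "u \<in> L1 \<Omega> \<Longrightarrow> v \<in> L1 \<Omega> \<Longrightarrow> (\<lambda>x. u x - v x) \<in> L1 \<Omega>"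
  and L1_cmult: "u \<in> L1 \<Omega> \<Longrightarrow> (\<lambda>x. c * u x) \<in> L1 \<Omega>"
  by (auto simp: L1_def)

lemma l1_norm_nonneg: "0 \<le> l1_norm \<Omega> u"
  by (simp add: l1_norm_def)

lemma l1_norm_cmult: "l1_norm \<Omega> (\<lambda>x. c * u x) = \<bar>c\<bar> * l1_norm \<Omega> u"
  by (simp add: l1_norm_def abs_mult)

lemma pairing_integrable:
  assumes "g \<in> Linf \<Omega>" "u \<in> L1 \<Omega>" shows "integrable (lebesgue_on \<Omega>) (\<lambda>x. g x * u x)"
proof -
  obtain K where K: "AE x in lebesgue_on \<Omega>. \<bar>g x\<bar> \<le> K" using assms(1) by (auto simp: Linf_iff)
  show ?thesis
  proof (rule Bochner_Integration.integrable_bound)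
    show "integrable (lebesgue_on \<Omega>) (\<lambda>x. K * u x)" using assms(2) by (simp add: L1_def)
    show "(\<lambda>x. g x * u x) \<in> borel_measurable (lebesgue_on \<Omega>)"
      using Linf_measurable[OF assms(1)] assms(2) by (simp add: L1_def)
    show "AE x in lebesgue_on \<Omega>. norm (g x * u x) \<le> norm (K * u x)"
      using K by eventually_elim (auto simp: abs_mult intro!: mult_right_mono)
  qed
qed

lemma pairing_add_right:
  "g \<in> Linf \<Omega> \<Longrightarrow> u \<in> L1 \<Omega> \<Longrightarrow> v \<in> L1 \<Omega> \<Longrightarrow>
     pairing \<Omega> g (\<lambda>x. u x + v x) = pairing \<Omega> g u + pairing \<Omega> g v"
  and pairing_diff_right:
  "g \<in> Linf \<Omega> \<Longrightarrow> u \<in> L1 \<Omega> \<Longrightarrow> v \<in> L1 \<Omega> \<Longrightarrow>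
     pairing \<Omega> g (\<lambda>x. u x - v x) = pairing \<Omega> g u - pairing \<Omega> g v"
  and pairing_diff_left:
  "g \<in> Linf \<Omega> \<Longrightarrow> h \<in> Linf \<Omega> \<Longrightarrow> u \<in> L1 \<Omega> \<Longrightarrow>
     pairing \<Omega> (\<lambda>x. g x - h x) u = pairing \<Omega> g u - pairing \<Omega> h u"
  by (simp_all add: pairing_def distrib_left right_diff_distrib left_diff_distrib pairing_integrable)

lemma pairing_cmult_right: "pairing \<Omega> g (\<lambda>x. c * u x) = c * pairing \<Omega> g u"
  by (simp add: pairing_def mult.left_commute)

lemma pairing_uminus_left: "pairing \<Omega> (\<lambda>x. - g x) u = - pairing \<Omega> g u"
  by (simp add: pairing_def)

lemma pairing_nonneg:
  assumes "ae_nonneg \<Omega> g" "ae_nonneg \<Omega> u" shows "0 \<le> pairing \<Omega> g u"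
proof -
  have "AE x in lebesgue_on \<Omega>. 0 \<le> g x * u x"
    using assms unfolding ae_le_def by eventually_elim simp
  then show ?thesis unfolding pairing_def by (rule integral_nonneg_AE)
qed


section \<open>Non-negative multipliers\<close>

lemma functional_add:
  "m \<in> Linf_dual \<Omega> \<Longrightarrow> g \<in> Linf \<Omega> \<Longrightarrow> h \<in> Linf \<Omega> \<Longrightarrow> m (\<lambda>x. g x + h x) = m g + m h"
  and functional_cmult: "m \<in> Linf_dual \<Omega> \<Longrightarrow> g \<in> Linf \<Omega> \<Longrightarrow> m (\<lambda>x. c * g x) = c * m g"
  unfolding Linf_dual_def by blast+

lemma functional_uminus:
  "m \<in> Linf_dual \<Omega> \<Longrightarrow> g \<in> Linf \<Omega> \<Longrightarrow> m (\<lambda>x. - g x) = - m g"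
  using functional_cmult[of m \<Omega> g "-1"] by simp

lemma functional_diff:
  assumes "m \<in> Linf_dual \<Omega>" "g \<in> Linf \<Omega>" "h \<in> Linf \<Omega>"
  shows "m (\<lambda>x. g x - h x) = m g - m h"
  using functional_add[OF assms(1,2) Linf_uminus[OF assms(3)]] functional_uminus[OF assms(1,3)]
  by simp

lemma functional_mono:
  assumes "m \<in> Linf_dual \<Omega>" "functional_nonneg \<Omega> m" "g \<in> Linf \<Omega>" "h \<in> Linf \<Omega>"
    and "AE x in lebesgue_on \<Omega>. g x \<le> h x"
  shows "m g \<le> m h"
proof -
  have "ae_nonneg \<Omega> (\<lambda>x. h x - g x)"
    using assms(5) unfolding ae_le_def by eventually_elim simp
  then have "0 \<le> m (\<lambda>x. h x - g x)"
    using assms Linf_diff unfolding functional_nonneg_def by blast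
  then show ?thesis using functional_diff[OF assms(1,4,3)] by simp
qed


text \<open>For non-negative \<open>\<mu>\<close> this is the norm of \<open>\<mu>\<close> in the dual of $L^\infty\times L^\infty$ with the
  maximum norm, see \<open>dpairing_abs_le\<close>.\<close>
definition mass :: "'m::finite functional \<times> 'm functional \<Rightarrow> real" where
  "mass \<mu> = dpairing \<mu> (\<lambda>_. 1, \<lambda>_. 1)"

lemma dpairing_diff:
  assumes "nonneg_multiplier \<Omega> \<mu>" "a \<in> Linf \<Omega> \<times> Linf \<Omega>" "b \<in> Linf \<Omega> \<times> Linf \<Omega>"
  shows "dpairing \<mu> (pair_diff a b) = dpairing \<mu> a - dpairing \<mu> b"
  using assms by (auto simp: nonneg_multiplier_def dpairing_def pair_diff_def functional_diff)

lemma dpairing_neg: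
  assumes "nonneg_multiplier \<Omega> \<mu>" "a \<in> Linf \<Omega> \<times> Linf \<Omega>"
  shows "dpairing \<mu> (pair_neg a) = - dpairing \<mu> a"
  using assms by (auto simp: nonneg_multiplier_def dpairing_def pair_neg_def functional_uminus)

lemma dpairing_mono:
  assumes "nonneg_multiplier \<Omega> \<mu>" "a \<in> Linf \<Omega> \<times> Linf \<Omega>" "b \<in> Linf \<Omega> \<times> Linf \<Omega>"
    and "AE x in lebesgue_on \<Omega>. fst a x \<le> fst b x" "AE x in lebesgue_on \<Omega>. snd a x \<le> snd b x"
  shows "dpairing \<mu> a \<le> dpairing \<mu> b"
  unfolding dpairing_def
  using assms by (intro add_mono functional_mono) (auto simp: nonneg_multiplier_def)

lemma dpairing_const:
  assumes "nonneg_multiplier \<Omega> \<mu>"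
  shows "dpairing \<mu> (\<lambda>_. c, \<lambda>_. c) = c * mass \<mu>"
proof -
  have "m (\<lambda>_. c) = c * m (\<lambda>_. 1)" if "m \<in> Linf_dual \<Omega>" for m :: "'a functional"
    using functional_cmult[OF that Linf_const, of c 1] by simp
  then show ?thesis
    using assms by (simp add: mass_def dpairing_def nonneg_multiplier_def distrib_left)
qed

lemma mass_nonneg:
  assumes "nonneg_multiplier \<Omega> \<mu>" shows "0 \<le> mass \<mu>"
  using assms unfolding mass_def dpairing_def nonneg_multiplier_def functional_nonneg_def
  by (auto simp: ae_le_def intro!: add_nonneg_nonneg)

lemma dpairing_ge:
  assumes "nonneg_multiplier \<Omega> \<mu>" "a \<in> Linf \<Omega> \<times> Linf \<Omega>"
    and "AE x in lebesgue_on \<Omega>. c \<le> fst a x" "AE x in lebesgue_on \<Omega>. c \<le> snd a x"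
  shows "c * mass \<mu> \<le> dpairing \<mu> a"
  using dpairing_mono[OF assms(1), of "(\<lambda>_. c, \<lambda>_. c)" a] assms by (simp add: dpairing_const)

lemma dpairing_le:
  assumes "nonneg_multiplier \<Omega> \<mu>" "a \<in> Linf \<Omega> \<times> Linf \<Omega>"
    and "AE x in lebesgue_on \<Omega>. fst a x \<le> c" "AE x in lebesgue_on \<Omega>. snd a x \<le> c"
  shows "dpairing \<mu> a \<le> c * mass \<mu>"
  using dpairing_mono[OF assms(1), of a "(\<lambda>_. c, \<lambda>_. c)"] assms by (simp add: dpairing_const)

lemma dpairing_abs_le:
  assumes "nonneg_multiplier \<Omega> \<mu>" "a \<in> Linf \<Omega> \<times> Linf \<Omega>"
    and "AE x in lebesgue_on \<Omega>. \<bar>fst a x\<bar> \<le> c" "AE x in lebesgue_on \<Omega>. \<bar>snd a x\<bar> \<le> c"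
  shows "\<bar>dpairing \<mu> a\<bar> \<le> c * mass \<mu>"
proof -
  have "dpairing \<mu> a \<le> c * mass \<mu>"
    using eventually_mono[OF assms(3) abs_le_D1] eventually_mono[OF assms(4) abs_le_D1]
    by (rule dpairing_le[OF assms(1,2)])
  moreover have "(- c) * mass \<mu> \<le> dpairing \<mu> a"
  proof (rule dpairing_ge[OF assms(1,2)])
    show "AE x in lebesgue_on \<Omega>. - c \<le> fst a x" using assms(3) by eventually_elim simp
    show "AE x in lebesgue_on \<Omega>. - c \<le> snd a x" using assms(4) by eventually_elim simp
  qed
  ultimately show ?thesis by simp
qed


section \<open>Bounded operators and their adjoints\<close>

text \<open>Boundedness from $L^1$ to $L^\infty$, stated with an explicit constant and a real-valued
  inequality almost everywhere, which combines well with linear arithmetic.\<close>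
definition bounded_op :: "(real ^ 'm::finite) set \<Rightarrow> real \<Rightarrow> ('m func \<Rightarrow> 'm func) \<Rightarrow> bool" where
  "bounded_op \<Omega> C T \<longleftrightarrow> (\<forall>u\<in>L1 \<Omega>. AE x in lebesgue_on \<Omega>. \<bar>T u x\<bar> \<le> C * l1_norm \<Omega> u)"

lemma linear_op_Linf: "linear_op \<Omega> T \<Longrightarrow> u \<in> L1 \<Omega> \<Longrightarrow> T u \<in> Linf \<Omega>"
  and linear_op_cong: "linear_op \<Omega> T \<Longrightarrow> u \<in> L1 \<Omega> \<Longrightarrow> v \<in> L1 \<Omega> \<Longrightarrow>
    AE x in lebesgue_on \<Omega>. u x = v x \<Longrightarrow> AE x in lebesgue_on \<Omega>. T u x = T v x"
  and linear_op_add: "linear_op \<Omega> T \<Longrightarrow> u \<in> L1 \<Omega> \<Longrightarrow> v \<in> L1 \<Omega> \<Longrightarrow>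
    AE x in lebesgue_on \<Omega>. T (\<lambda>x. u x + v x) x = T u x + T v x"
  and linear_op_cmult: "linear_op \<Omega> T \<Longrightarrow> u \<in> L1 \<Omega> \<Longrightarrow>
    AE x in lebesgue_on \<Omega>. T (\<lambda>x. c * u x) x = c * T u x"
  unfolding linear_op_def ae_eq_def by blast+

lemma linear_op_sub:
  assumes "linear_op \<Omega> T" "u \<in> L1 \<Omega>" "v \<in> L1 \<Omega>"
  shows "AE x in lebesgue_on \<Omega>. T (\<lambda>x. u x - v x) x = T u x - T v x"
  using linear_op_add[OF assms(1) L1_diff[OF assms(2,3)] assms(3)]
  by eventually_elim simp

lemma linear_op_difference:
  assumes S: "linear_op \<Omega> S" and T: "linear_op \<Omega> T"
  shows "linear_op \<Omega> (\<lambda>u x. S u x - T u x)"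
  unfolding linear_op_def ae_eq_def
proof (intro conjI ballI allI impI)
  fix u assume u: "u \<in> L1 \<Omega>"
  show "(\<lambda>x. S u x - T u x) \<in> Linf \<Omega>"
    using u S T by (intro Linf_diff linear_op_Linf)
  show "AE x in lebesgue_on \<Omega>. S (\<lambda>x. c * u x) x - T (\<lambda>x. c * u x) x = c * (S u x - T u x)" for c
    using linear_op_cmult[OF S u, of c] linear_op_cmult[OF T u, of c]
    by eventually_elim (simp add: right_diff_distrib)
  fix v assume v: "v \<in> L1 \<Omega>"
  show "AE x in lebesgue_on \<Omega>. S (\<lambda>x. u x + v x) x - T (\<lambda>x. u x + v x) x = S u x - T u x + (S v x - T v x)"
    using linear_op_add[OF S u v] linear_op_add[OF T u v]
    by eventually_elim simp
  assume uv: "AE x in lebesgue_on \<Omega>. u x = v x"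
  show "AE x in lebesgue_on \<Omega>. S u x - T u x = S v x - T v x"
    using linear_op_cong[OF S u v uv] linear_op_cong[OF T u v uv]
    by eventually_elim simp
qed

lemma bounded_opI_unit_ball:
  assumes T: "linear_op \<Omega> T"
    and le: "\<And>u. u \<in> L1 \<Omega> \<Longrightarrow> l1_norm \<Omega> u \<le> 1 \<Longrightarrow> linf_norm \<Omega> (T u) \<le> ereal C"
  shows "bounded_op \<Omega> C T"
  unfolding bounded_op_def
proof (intro ballI)
  fix u assume u: "u \<in> L1 \<Omega>"
  define s where "s = l1_norm \<Omega> u"
  show "AE x in lebesgue_on \<Omega>. \<bar>T u x\<bar> \<le> C * l1_norm \<Omega> u"
  proof (cases "s = 0")
    case True
    then have "AE x in lebesgue_on \<Omega>. \<bar>u x\<bar> = 0"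
      using u integral_nonneg_eq_0_iff_AE[of "lebesgue_on \<Omega>" "\<lambda>x. \<bar>u x\<bar>"]
      by (simp add: s_def l1_norm_def L1_def)
    then have "AE x in lebesgue_on \<Omega>. u x = 0 * u x" by eventually_elim simp
    from linear_op_cong[OF T u L1_cmult[OF u] this] linear_op_cmult[OF T u, of 0]
    show ?thesis by eventually_elim (use True in \<open>simp add: s_def\<close>)
  next
    case False
    then have s: "s > 0" using l1_norm_nonneg[of \<Omega> u] by (simp add: s_def)
    have w: "(\<lambda>x. (1/s) * u x) \<in> L1 \<Omega>" by (rule L1_cmult[OF u])
    have "l1_norm \<Omega> (\<lambda>x. (1/s) * u x) \<le> 1"
      using s by (subst l1_norm_cmult) (simp add: s_def)
    then have "AE x in lebesgue_on \<Omega>. \<bar>T (\<lambda>x. (1/s) * u x) x\<bar> \<le> C"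
      using le[OF w] linear_op_Linf[OF T w] by (simp add: linf_norm_le_iff Linf_measurable)
    with linear_op_cmult[OF T u, of "1/s"] show ?thesis
    proof eventually_elim
      case (elim x)
      then have "\<bar>T u x\<bar> / s \<le> C" using s by (simp add: abs_mult)
      then show ?case using s by (simp add: s_def[symmetric] pos_divide_le_eq)
    qed
  qed
qed

lemma bounded_op_diff:
  assumes "bounded_op \<Omega> C S" "bounded_op \<Omega> D T"
  shows "bounded_op \<Omega> (C + D) (\<lambda>u x. S u x - T u x)"
  unfolding bounded_op_def
proof (intro ballI)
  fix u assume u: "u \<in> L1 \<Omega>"
  have "AE x in lebesgue_on \<Omega>. \<bar>S u x\<bar> \<le> C * l1_norm \<Omega> u"
    "AE x in lebesgue_on \<Omega>. \<bar>T u x\<bar> \<le> D * l1_norm \<Omega> u"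
    using assms u unfolding bounded_op_def by blast+
  then show "AE x in lebesgue_on \<Omega>. \<bar>S u x - T u x\<bar> \<le> (C + D) * l1_norm \<Omega> u"
    by eventually_elim (simp add: distrib_right)
qed

lemma bounded_op_mono:
  assumes "bounded_op \<Omega> C T" "C \<le> D"
  shows "bounded_op \<Omega> D T"
  unfolding bounded_op_def
proof (intro ballI)
  fix u assume "u \<in> L1 \<Omega>"
  then have "AE x in lebesgue_on \<Omega>. \<bar>T u x\<bar> \<le> C * l1_norm \<Omega> u"
    using assms(1) by (simp add: bounded_op_def)
  moreover have "C * l1_norm \<Omega> u \<le> D * l1_norm \<Omega> u"
    using assms(2) l1_norm_nonneg by (rule mult_right_mono)
  ultimately show "AE x in lebesgue_on \<Omega>. \<bar>T u x\<bar> \<le> D * l1_norm \<Omega> u"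
    by (auto elim: eventually_mono)
qed

lemma bounded_op_uminus: "bounded_op \<Omega> C T \<Longrightarrow> bounded_op \<Omega> C (\<lambda>u x. - T u x)"
  by (simp add: bounded_op_def)

lemma bounded_op_cong:
  assumes "bounded_op \<Omega> C S" "\<And>u. u \<in> L1 \<Omega> \<Longrightarrow> AE x in lebesgue_on \<Omega>. T u x = S u x"
  shows "bounded_op \<Omega> C T"
  unfolding bounded_op_def
proof (intro ballI)
  fix u assume u: "u \<in> L1 \<Omega>"
  have "AE x in lebesgue_on \<Omega>. \<bar>S u x\<bar> \<le> C * l1_norm \<Omega> u"
    using assms(1) u unfolding bounded_op_def by blast
  with assms(2)[OF u] show "AE x in lebesgue_on \<Omega>. \<bar>T u x\<bar> \<le> C * l1_norm \<Omega> u"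
    by eventually_elim simp
qed

text \<open>For $u\geq0$ the quantity $N(u)=\|Pu\|_\infty$ is monotone, so
  \<open>monotone_functional_bounded\<close> applies; general \<open>u\<close> are split into positive and negative part.\<close>
lemma positive_op_bounded:
  assumes dom: "bounded_domain \<Omega>" and P: "positive_op \<Omega> P"
  shows "\<exists>C. bounded_op \<Omega> C P"
proof -
  have lin: "linear_op \<Omega> P" using P by (simp add: positive_op_def)
  have fin: "ereal (real_of_ereal (linf_norm \<Omega> (P u))) = linf_norm \<Omega> (P u)" if "u \<in> L1 \<Omega>" for u
    using linear_op_Linf[OF lin that] linf_norm_nonneg[OF dom, of "P u"]
    by (cases "linf_norm \<Omega> (P u)") (auto simp: Linf_def)
  have nonneg: "AE x in lebesgue_on \<Omega>. 0 \<le> P u x"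
    if "integrable (lebesgue_on \<Omega>) u" "AE x in lebesgue_on \<Omega>. 0 \<le> u x" for u
    using P that unfolding positive_op_def L1_def ae_le_def by blast
  have "\<exists>C\<ge>0. \<forall>u. integrable (lebesgue_on \<Omega>) u \<longrightarrow> (AE x in lebesgue_on \<Omega>. 0 \<le> u x) \<longrightarrow>
      real_of_ereal (linf_norm \<Omega> (P u)) \<le> C * (LINT x|lebesgue_on \<Omega>. u x)"
  proof (rule monotone_functional_bounded)
    fix u v :: "'a func" assume u: "integrable (lebesgue_on \<Omega>) u" and v: "integrable (lebesgue_on \<Omega>) v"
      and u0: "AE x in lebesgue_on \<Omega>. 0 \<le> u x" and uv: "AE x in lebesgue_on \<Omega>. u x \<le> v x"
    have vu: "AE x in lebesgue_on \<Omega>. 0 \<le> P (\<lambda>x. v x - u x) x"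
    proof (rule nonneg)
      show "AE x in lebesgue_on \<Omega>. 0 \<le> v x - u x" using uv by eventually_elim simp
    qed (use u v in simp)
    have sub: "AE x in lebesgue_on \<Omega>. P (\<lambda>x. v x - u x) x = P v x - P u x"
      using u v by (intro linear_op_sub[OF lin]) (auto simp: L1_def)
    have "AE x in lebesgue_on \<Omega>. ereal \<bar>P u x\<bar> \<le> ereal \<bar>P v x\<bar>"
      using nonneg[OF u u0] vu sub by eventually_elim simp
    then have "linf_norm \<Omega> (P u) \<le> linf_norm \<Omega> (P v)"
      unfolding linf_norm_def
      using linear_op_Linf[OF lin, of u] u
      by (intro esssup_AE_mono) (auto simp: L1_def dest!: Linf_measurable)
    then show "real_of_ereal (linf_norm \<Omega> (P u)) \<le> real_of_ereal (linf_norm \<Omega> (P v))"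
      using fin[of u] fin[of v] u v by (simp add: L1_def) (metis ereal_less_eq(3))
  next
    fix c :: real and u :: "'a func" assume c: "0 < c" and u: "integrable (lebesgue_on \<Omega>) u"
    have u': "u \<in> L1 \<Omega>" using u by (simp add: L1_def)
    have "linf_norm \<Omega> (P (\<lambda>x. c * u x)) = esssup (lebesgue_on \<Omega>) (\<lambda>x. ereal c * ereal \<bar>P u x\<bar>)"
      unfolding linf_norm_def
    proof (rule esssup_AE_cong)
      show "AE x in lebesgue_on \<Omega>. ereal \<bar>P (\<lambda>x. c * u x) x\<bar> = ereal c * ereal \<bar>P u x\<bar>"
        using linear_op_cmult[OF lin u', of c] by eventually_elim (use c in \<open>simp add: abs_mult\<close>)
    qed (use linear_op_Linf[OF lin u'] linear_op_Linf[OF lin L1_cmult[OF u', of c]] in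
          \<open>auto dest!: Linf_measurable\<close>)
    also have "\<dots> = ereal c * linf_norm \<Omega> (P u)"
      unfolding linf_norm_def by (rule esssup_cmult[OF c])
    finally show "real_of_ereal (linf_norm \<Omega> (P (\<lambda>x. c * u x))) = c * real_of_ereal (linf_norm \<Omega> (P u))"
      by simp
  qed
  then obtain C where C: "\<And>u. integrable (lebesgue_on \<Omega>) u \<Longrightarrow> AE x in lebesgue_on \<Omega>. 0 \<le> u x \<Longrightarrow>
      real_of_ereal (linf_norm \<Omega> (P u)) \<le> C * (LINT x|lebesgue_on \<Omega>. u x)"
    by blast
  have bd: "AE x in lebesgue_on \<Omega>. \<bar>P u x\<bar> \<le> C * (LINT x|lebesgue_on \<Omega>. u x)"
    if "integrable (lebesgue_on \<Omega>) u" "AE x in lebesgue_on \<Omega>. 0 \<le> u x" for u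
  proof -
    have "linf_norm \<Omega> (P u) \<le> ereal (C * (LINT x|lebesgue_on \<Omega>. u x))"
      using C[OF that] fin[of u] that(1) by (simp add: L1_def) (metis ereal_less_eq(3))
    then show ?thesis
      using linear_op_Linf[OF lin, of u] that(1)
      by (subst (asm) linf_norm_le_iff) (auto simp: L1_def dest: Linf_measurable)
  qed
  have "bounded_op \<Omega> C P"
    unfolding bounded_op_def
  proof (intro ballI)
    fix u assume "u \<in> L1 \<Omega>"
    then have u: "integrable (lebesgue_on \<Omega>) u" by (simp add: L1_def)
    define a where "a = (\<lambda>x. max (u x) 0)"
    define b where "b = (\<lambda>x. max (- u x) 0)"
    have a: "integrable (lebesgue_on \<Omega>) a" and b: "integrable (lebesgue_on \<Omega>) b"
      using u unfolding a_def b_def by (auto intro!: integrable_max)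
    have "u = (\<lambda>x. a x - b x)" by (auto simp: a_def b_def)
    then have 1: "AE x in lebesgue_on \<Omega>. P u x = P a x - P b x"
      using linear_op_sub[OF lin, of a b] a b by (simp add: L1_def)
    have "(\<lambda>x. \<bar>u x\<bar>) = (\<lambda>x. a x + b x)" by (auto simp: a_def b_def)
    then have 2: "l1_norm \<Omega> u = (LINT x|lebesgue_on \<Omega>. a x) + (LINT x|lebesgue_on \<Omega>. b x)"
      using a b by (simp add: l1_norm_def)
    have "AE x in lebesgue_on \<Omega>. \<bar>P a x\<bar> \<le> C * (LINT x|lebesgue_on \<Omega>. a x)"
      "AE x in lebesgue_on \<Omega>. \<bar>P b x\<bar> \<le> C * (LINT x|lebesgue_on \<Omega>. b x)"
      using a b by (auto intro!: bd simp: a_def b_def)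
    with 1 show "AE x in lebesgue_on \<Omega>. \<bar>P u x\<bar> \<le> C * l1_norm \<Omega> u"
      unfolding 2 by eventually_elim (simp add: distrib_left)
  qed
  then show ?thesis by blast
qed

text \<open>\<open>A\<close> inherits boundedness from its regular lower bound \<open>L\<close>: with $L=P-Q$, the operator $A=(A-L)+P-Q$ is built from three positive operators.\<close>
lemma regular_minorant_bounded:
  assumes dom: "bounded_domain \<Omega>" and A: "linear_op \<Omega> A" and L: "regular_op \<Omega> L"
    and le: "op_le \<Omega> L A"
  shows "\<exists>C. bounded_op \<Omega> C A"
proof -
  obtain P Q where P: "positive_op \<Omega> P" and Q: "positive_op \<Omega> Q"
    and eq: "\<And>u. u \<in> L1 \<Omega> \<Longrightarrow> AE x in lebesgue_on \<Omega>. L u x = P u x - Q u x"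
    using L unfolding regular_op_def ae_eq_def by blast
  have linL: "linear_op \<Omega> L" using L by (simp add: regular_op_def)
  have "positive_op \<Omega> (\<lambda>u x. A u x - L u x)"
    using le linear_op_difference[OF A linL] unfolding positive_op_def op_le_def by blast
  then obtain C where C: "bounded_op \<Omega> C (\<lambda>u x. A u x - L u x)"
    using positive_op_bounded[OF dom] by blast
  obtain D E where D: "bounded_op \<Omega> D P" and E: "bounded_op \<Omega> E Q"
    using positive_op_bounded[OF dom] P Q by blast
  have "bounded_op \<Omega> (C + (E + D)) A"
  proof (rule bounded_op_cong[OF bounded_op_diff[OF C bounded_op_diff[OF E D]]])
    fix u assume "u \<in> L1 \<Omega>"
    from eq[OF this] show "AE x in lebesgue_on \<Omega>. A u x = A u x - L u x - (Q u x - P u x)"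
      by eventually_elim simp
  qed
  then show ?thesis by blast
qed

lemma op_pair_Linf:
  "linear_op \<Omega> L \<Longrightarrow> linear_op \<Omega> U \<Longrightarrow> u \<in> L1 \<Omega> \<Longrightarrow> op_pair L U u \<in> Linf \<Omega> \<times> Linf \<Omega>"
  by (simp add: op_pair_def linear_op_Linf Linf_uminus)

lemma op_norm_gap_bounded:
  assumes A: "linear_op \<Omega> A" and L: "linear_op \<Omega> L" and U: "linear_op \<Omega> U"
    and gap: "op_norm \<Omega> (linf_norm2 \<Omega>) (\<lambda>u. pair_diff (op_pair A A u) (op_pair L U u)) \<le> ereal \<eta>"
  shows "bounded_op \<Omega> \<eta> (\<lambda>u x. A u x - L u x)"
    and "bounded_op \<Omega> \<eta> (\<lambda>u x. U u x - A u x)"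
proof -
  have ball: "linf_norm2 \<Omega> (pair_diff (op_pair A A u) (op_pair L U u)) \<le> ereal \<eta>"
    if "u \<in> L1 \<Omega>" "l1_norm \<Omega> u \<le> 1" for u
    using gap that unfolding op_norm_def SUP_le_iff by blast
  show "bounded_op \<Omega> \<eta> (\<lambda>u x. A u x - L u x)"
  proof (rule bounded_opI_unit_ball[OF linear_op_difference[OF A L]])
    fix u assume "u \<in> L1 \<Omega>" "l1_norm \<Omega> u \<le> 1"
    from ball[OF this] show "linf_norm \<Omega> (\<lambda>x. A u x - L u x) \<le> ereal \<eta>"
      by (simp add: linf_norm2_def pair_diff_def op_pair_def)
  qed
  show "bounded_op \<Omega> \<eta> (\<lambda>u x. U u x - A u x)"
  proof (rule bounded_opI_unit_ball[OF linear_op_difference[OF U A]])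
    fix u assume "u \<in> L1 \<Omega>" "l1_norm \<Omega> u \<le> 1"
    from ball[OF this] show "linf_norm \<Omega> (\<lambda>x. U u x - A u x) \<le> ereal \<eta>"
      by (simp add: linf_norm2_def pair_diff_def op_pair_def)
  qed
qed

lemma dpairing_op_pair_abs_le:
  assumes "nonneg_multiplier \<Omega> \<mu>" "linear_op \<Omega> L" "linear_op \<Omega> U"
    "bounded_op \<Omega> C L" "bounded_op \<Omega> C U" "u \<in> L1 \<Omega>"
  shows "\<bar>dpairing \<mu> (op_pair L U u)\<bar> \<le> C * l1_norm \<Omega> u * mass \<mu>"
  using assms by (intro dpairing_abs_le op_pair_Linf) (auto simp: op_pair_def bounded_op_def)

text \<open>The adjoint is chosen by \<open>SOME\<close>, so its defining property rests on the existence of a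
  representing function.\<close>
lemma adjoint_op_represents:
  assumes dom: "bounded_domain \<Omega>" and \<mu>: "nonneg_multiplier \<Omega> \<mu>"
    and L: "linear_op \<Omega> L" "bounded_op \<Omega> C L" and U: "linear_op \<Omega> U" "bounded_op \<Omega> C U"
  shows "adjoint_op \<Omega> (op_pair L U) \<mu> \<in> Linf \<Omega>"
    and "u \<in> L1 \<Omega> \<Longrightarrow> pairing \<Omega> (adjoint_op \<Omega> (op_pair L U) \<mu>) u = dpairing \<mu> (op_pair L U u)"
proof -
  interpret finite_measure "lebesgue_on \<Omega>" by (rule finite_measure_domain[OF dom])
  let ?l = "\<lambda>u. dpairing \<mu> (op_pair L U u)"
  have m: "fst \<mu> \<in> Linf_dual \<Omega>" "snd \<mu> \<in> Linf_dual \<Omega>"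
    using \<mu> by (auto simp: nonneg_multiplier_def)
  have cong: "dpairing \<mu> a = dpairing \<mu> b" if "a \<in> Linf \<Omega> \<times> Linf \<Omega>" "b \<in> Linf \<Omega> \<times> Linf \<Omega>"
      "AE x in lebesgue_on \<Omega>. fst a x = fst b x" "AE x in lebesgue_on \<Omega>. snd a x = snd b x" for a b
    using that by (intro antisym dpairing_mono[OF \<mu>]) (auto elim: eventually_mono)
  have "\<exists>q\<in>borel_measurable (lebesgue_on \<Omega>). (\<exists>K. AE x in lebesgue_on \<Omega>. \<bar>q x\<bar> \<le> K) \<and>
      (\<forall>u. integrable (lebesgue_on \<Omega>) u \<longrightarrow> (LINT x|lebesgue_on \<Omega>. q x * u x) = ?l u)"
  proof (rule L1_functional_representation[where C="C * mass \<mu>"])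
    fix u :: "'a func" assume "integrable (lebesgue_on \<Omega>) u"
    then have u: "u \<in> L1 \<Omega>" by (simp add: L1_def)
    show "\<bar>?l u\<bar> \<le> C * mass \<mu> * (LINT x|lebesgue_on \<Omega>. \<bar>u x\<bar>)"
      using dpairing_op_pair_abs_le[OF \<mu> L(1) U(1) L(2) U(2) u] by (simp add: l1_norm_def mult_ac)
    show "?l (\<lambda>x. c * u x) = c * ?l u" for c
    proof -
      have "?l (\<lambda>x. c * u x) = dpairing \<mu> (\<lambda>x. c * fst (op_pair L U u) x, \<lambda>x. c * snd (op_pair L U u) x)"
      proof (rule cong)
        show "AE x in lebesgue_on \<Omega>. fst (op_pair L U (\<lambda>x. c * u x)) x =
            fst (\<lambda>x. c * fst (op_pair L U u) x, \<lambda>x. c * snd (op_pair L U u) x) x"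
          using linear_op_cmult[OF L(1) u, of c] by (simp add: op_pair_def)
        show "AE x in lebesgue_on \<Omega>. snd (op_pair L U (\<lambda>x. c * u x)) x =
            snd (\<lambda>x. c * fst (op_pair L U u) x, \<lambda>x. c * snd (op_pair L U u) x) x"
          using linear_op_cmult[OF U(1) u, of c] by (simp add: op_pair_def)
      next
        show "(\<lambda>x. c * fst (op_pair L U u) x, \<lambda>x. c * snd (op_pair L U u) x) \<in> Linf \<Omega> \<times> Linf \<Omega>"
          using op_pair_Linf[OF L(1) U(1) u] by (intro SigmaI Linf_cmult) auto
      qed (use op_pair_Linf[OF L(1) U(1) L1_cmult[OF u]] in simp)
      also have "\<dots> = c * ?l u"
        using op_pair_Linf[OF L(1) U(1) u]
        by (auto simp: dpairing_def distrib_left functional_cmult[OF m(1)] functional_cmult[OF m(2)])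
      finally show ?thesis .
    qed
    fix v :: "'a func" assume "integrable (lebesgue_on \<Omega>) v"
    then have v: "v \<in> L1 \<Omega>" by (simp add: L1_def)
    have "?l (\<lambda>x. u x + v x) = dpairing \<mu> (\<lambda>x. L u x + L v x, \<lambda>x. - U u x + - U v x)"
    proof (rule cong)
      show "AE x in lebesgue_on \<Omega>. fst (op_pair L U (\<lambda>x. u x + v x)) x =
          fst (\<lambda>x. L u x + L v x, \<lambda>x. - U u x + - U v x) x"
        using linear_op_add[OF L(1) u v] by (simp add: op_pair_def)
      show "AE x in lebesgue_on \<Omega>. snd (op_pair L U (\<lambda>x. u x + v x)) x =
          snd (\<lambda>x. L u x + L v x, \<lambda>x. - U u x + - U v x) x"
        using linear_op_add[OF U(1) u v] by (auto simp: op_pair_def elim: eventually_mono)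
    next
      show "(\<lambda>x. L u x + L v x, \<lambda>x. - U u x + - U v x) \<in> Linf \<Omega> \<times> Linf \<Omega>"
        using linear_op_Linf[OF L(1) u] linear_op_Linf[OF L(1) v]
          linear_op_Linf[OF U(1) u] linear_op_Linf[OF U(1) v]
        by (intro SigmaI Linf_add Linf_uminus)
    qed (use op_pair_Linf[OF L(1) U(1) L1_add[OF u v]] in simp)
    also have "\<dots> = ?l u + ?l v"
      using op_pair_Linf[OF L(1) U(1) u] op_pair_Linf[OF L(1) U(1) v]
        functional_add[OF m(1), of "L u" "L v"]
        functional_add[OF m(2), of "\<lambda>x. - U u x" "\<lambda>x. - U v x"]
      by (simp add: dpairing_def op_pair_def)
    finally show "?l (\<lambda>x. u x + v x) = ?l u + ?l v" .
  qed
  then have "\<exists>q. q \<in> Linf \<Omega> \<and> (\<forall>u\<in>L1 \<Omega>. pairing \<Omega> q u = ?l u)"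
    unfolding Linf_iff pairing_def L1_def by auto
  from someI_ex[OF this]
  show "adjoint_op \<Omega> (op_pair L U) \<mu> \<in> Linf \<Omega>"
    and "u \<in> L1 \<Omega> \<Longrightarrow> pairing \<Omega> (adjoint_op \<Omega> (op_pair L U) \<mu>) u = dpairing \<mu> (op_pair L U u)"
    unfolding adjoint_op_def by blast+
qed

section \<open>Weak-* compactness\<close>

text \<open>Tychonoff's theorem for a product of compact intervals.\<close>
lemma compact_pointwise_bounded:
  fixes K :: "'i \<Rightarrow> real"
  shows "compact {x. \<forall>i. \<bar>x i\<bar> \<le> K i}"
proof -
  have "{x. \<forall>i. \<bar>x i\<bar> \<le> K i} = PiE UNIV (\<lambda>i. {- K i..K i})"
    by (auto simp: PiE_UNIV_domain abs_le_iff minus_le_iff)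
  moreover have "compactin (product_topology (\<lambda>i::'i. euclidean::real topology) UNIV) (PiE UNIV (\<lambda>i. {- K i..K i}))"
    by (simp add: compactin_PiE)
  ultimately show ?thesis
    unfolding euclidean_product_topology by simp
qed

text \<open>A cluster point \<open>x\<close> of the sequence exists by compactness; the filter generated by the tails
  of the sequence and the preimages of neighbourhoods of \<open>x\<close> is proper and converges to \<open>x\<close> in
  each coordinate.\<close>
lemma pointwise_bounded_subnet:
  fixes g :: "nat \<Rightarrow> 'i \<Rightarrow> real"
  assumes bd: "\<And>n i. \<bar>g n i\<bar> \<le> K i"
  shows "\<exists>F. F \<noteq> bot \<and> F \<le> sequentially \<and> (\<forall>i. \<exists>l. ((\<lambda>n. g n i) \<longlongrightarrow> l) F)"
proof -
  have "filtermap g sequentially \<noteq> bot" by (simp add: filtermap_bot_iff)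
  moreover have "eventually (\<lambda>x. x \<in> {x. \<forall>i. \<bar>x i\<bar> \<le> K i}) (filtermap g sequentially)"
    using bd by (simp add: eventually_filtermap)
  ultimately obtain x where x: "inf (nhds x) (filtermap g sequentially) \<noteq> bot"
    using compact_pointwise_bounded[of K] unfolding compact_filter by meson
  define F where "F = inf sequentially (filtercomap g (nhds x))"
  have "F \<noteq> bot"
  proof
    assume "F = bot"
    then have "eventually (\<lambda>_. False) F" by simp
    then obtain P Q where P: "eventually P sequentially" and Q: "eventually Q (nhds x)"
      and PQ: "\<And>n. P n \<Longrightarrow> Q (g n) \<Longrightarrow> False"
      unfolding F_def eventually_inf eventually_filtercomap by blast
    have "eventually (\<lambda>y. \<not> Q y) (filtermap g sequentially)"
      unfolding eventually_filtermap using P by eventually_elim (use PQ in blast)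
    with Q have "eventually (\<lambda>_. False) (inf (nhds x) (filtermap g sequentially))"
      unfolding eventually_inf by blast
    with x show False by (simp add: eventually_False)
  qed
  moreover have "F \<le> sequentially" by (simp add: F_def)
  moreover have "((\<lambda>n. g n i) \<longlongrightarrow> x i) F" for i
  proof -
    have "filterlim g (nhds x) F"
      unfolding F_def by (rule filterlim_mono[OF filterlim_filtercomap order_refl]) simp
    then show ?thesis
      using continuous_on_tendsto_compose[OF continuous_on_product_coordinates, of g x F i] by simp
  qed
  ultimately show ?thesis by blast
qed

text \<open>With countably many coordinates the product is metrisable, hence sequentially compact.\<close>
lemma pointwise_bounded_subsequence:
  fixes g :: "nat \<Rightarrow> 'i::countable \<Rightarrow> real"
  assumes bd: "\<And>n i. \<bar>g n i\<bar> \<le> K i"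
  shows "\<exists>r::nat \<Rightarrow> nat. strict_mono r \<and> (\<forall>i. convergent (\<lambda>n. g (r n) i))"
proof -
  have "seq_compact {x. \<forall>i. \<bar>x i\<bar> \<le> K i}"
    using compact_pointwise_bounded[of K] by (simp add: compact_eq_seq_compact_metric)
  then obtain x r where r: "strict_mono r" "(g \<circ> r) \<longlonglongrightarrow> x"
    using bd unfolding seq_compact_def by (drule_tac spec[of _ g]) auto
  have "(\<lambda>n. g (r n) i) \<longlonglongrightarrow> x i" for i
    using continuous_on_tendsto_compose[OF continuous_on_product_coordinates r(2), of i]
    by (simp add: o_def)
  with r(1) show ?thesis by (auto simp: convergent_def)
qed

lemma fin_space_add:
  assumes "is_norm_on_fin_space \<Omega> J" "u \<in> fin_space \<Omega> J" "v \<in> fin_space \<Omega> J"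
  shows "(\<lambda>x. u x + v x) \<in> fin_space \<Omega> J"
proof -
  have "J (\<lambda>x. u x + v x) \<le> J u + J v"
    using assms unfolding is_norm_on_fin_space_def by blast
  also have "\<dots> < \<infinity>" using assms(2,3) by (simp add: fin_space_def)
  finally show ?thesis using assms(2,3) by (simp add: fin_space_def L1_add)
qed

lemma fin_space_cmult:
  assumes "is_norm_on_fin_space \<Omega> J" "u \<in> fin_space \<Omega> J"
  shows "(\<lambda>x. c * u x) \<in> fin_space \<Omega> J"
proof -
  have J: "J (\<lambda>x. c * u x) = ereal \<bar>c\<bar> * J u" and 0: "0 \<le> J u"
    using assms unfolding is_norm_on_fin_space_def by blast+
  have "J u < \<infinity>" using assms(2) by (simp add: fin_space_def)
  with 0 obtain r where "J u = ereal r" by (cases "J u") auto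
  then have "J (\<lambda>x. c * u x) < \<infinity>" using J by simp
  then show ?thesis using assms(2) by (simp add: fin_space_def L1_cmult)
qed

text \<open>Banach--Alaoglu. The index \<open>i\<close> lets several sequences converge along one common filter; it is
  countable so that in the separable case pairs of an index and an element of the dense set still
  form countably many coordinates. There, convergence on the dense set extends to the whole space
  by equicontinuity.\<close>
lemma weak_star_compactness:
  fixes p :: "'i::countable \<Rightarrow> nat \<Rightarrow> 'm::finite func"
  assumes norm: "is_norm_on_fin_space \<Omega> J"
    and p: "\<And>i n. p i n \<in> Linf \<Omega>"
    and bound: "\<And>i n v. v \<in> fin_space \<Omega> J \<Longrightarrow> ereal \<bar>pairing \<Omega> (p i n) v\<bar> \<le> ereal (C i) * J v"
  shows "\<exists>F. subsequence_filter \<Omega> J F \<and> (\<forall>i. \<exists>q. weak_star_lim \<Omega> J (p i) q F)"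
proof -
  let ?V = "fin_space \<Omega> J"
  define j where "j v = real_of_ereal (J v)" for v
  have j: "J v = ereal (j v)" if "v \<in> ?V" for v
    using that norm unfolding is_norm_on_fin_space_def fin_space_def j_def
    by (cases "J v") auto
  have j0: "0 \<le> j v" if "v \<in> ?V" for v
    using that norm j[OF that] unfolding is_norm_on_fin_space_def by auto
  have bd: "\<bar>pairing \<Omega> (p i n) v\<bar> \<le> C i * j v" if "v \<in> ?V" for i n v
    using bound[OF that, of i n] j[OF that] by simp
  have V_L1: "v \<in> L1 \<Omega>" if "v \<in> ?V" for v using that by (simp add: fin_space_def)
  have "\<exists>F. subsequence_filter \<Omega> J F \<and> (\<forall>i. \<forall>v\<in>?V. \<exists>l. ((\<lambda>n. pairing \<Omega> (p i n) v) \<longlongrightarrow> l) F)"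
  proof (cases "fin_separable \<Omega> J")
    case False
    \<comment> \<open>Coordinates are pairs of an index and a function; those outside the space are set to 0.\<close>
    define g where "g n a = (if snd a \<in> ?V then pairing \<Omega> (p (fst a) n) (snd a) else 0)" for n a
    have "\<bar>g n a\<bar> \<le> (if snd a \<in> ?V then C (fst a) * j (snd a) else 0)" for n a
      using bd by (auto simp: g_def)
    from pointwise_bounded_subnet[of g, OF this]
    obtain F where F: "F \<noteq> bot" "F \<le> sequentially" "\<And>a. \<exists>l. ((\<lambda>n. g n a) \<longlongrightarrow> l) F"
      by blast
    have "\<exists>l. ((\<lambda>n. pairing \<Omega> (p i n) v) \<longlongrightarrow> l) F" if "v \<in> ?V" for i v
      using F(3)[of "(i, v)"] that by (simp add: g_def)
    with F(1,2) False show ?thesis by (auto simp: subsequence_filter_def)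
  next
    case True
    then obtain D where D: "countable D" "D \<subseteq> ?V"
      and dense: "\<And>u e. u \<in> ?V \<Longrightarrow> e > 0 \<Longrightarrow> \<exists>d\<in>D. J (\<lambda>x. u x - d x) < ereal e"
      unfolding fin_separable_def by blast
    define g where "g n a = (if from_nat_into D (snd a) \<in> ?V
        then pairing \<Omega> (p (fst a) n) (from_nat_into D (snd a)) else 0)" for n a
    have "\<bar>g n a\<bar> \<le> (if from_nat_into D (snd a) \<in> ?V
        then C (fst a) * j (from_nat_into D (snd a)) else 0)" for n a
      using bd by (auto simp: g_def)
    from pointwise_bounded_subsequence[of g, OF this]
    obtain r :: "nat \<Rightarrow> nat" where r: "strict_mono r" and conv: "\<And>a. convergent (\<lambda>n. g (r n) a)" by blast
    have conv_D: "Cauchy (\<lambda>n. pairing \<Omega> (p i (r n)) d)" if "d \<in> D" for i d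
    proof -
      obtain k where "from_nat_into D k = d" using from_nat_into_surj D(1) \<open>d \<in> D\<close> by metis
      then show ?thesis using conv[of "(i, k)"] D(2) \<open>d \<in> D\<close>
        by (auto simp: g_def Cauchy_convergent_iff)
    qed
    have "Cauchy (\<lambda>n. pairing \<Omega> (p i (r n)) v)" if v: "v \<in> ?V" for i v
      unfolding Cauchy_def dist_real_def
    proof (intro allI impI)
      fix e :: real assume e: "0 < e"
      define s where "s = e / (3 * (\<bar>C i\<bar> + 1))"
      have s: "s > 0" using e by (simp add: s_def add_nonneg_pos)
      from dense[OF v s] obtain d where d: "d \<in> D" and Jd: "J (\<lambda>x. v x - d x) < ereal s" by blast
      let ?w = "\<lambda>x. v x - d x"
      have dV: "d \<in> ?V" using d D(2) by blast
      have w: "?w \<in> ?V" using Jd v dV by (auto simp: fin_space_def L1_diff)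
      have jw: "j ?w < s" using Jd j[OF w] by simp
      have small: "\<bar>pairing \<Omega> (p i (r n)) v - pairing \<Omega> (p i (r n)) d\<bar> \<le> e / 3" for n
      proof -
        have "\<bar>pairing \<Omega> (p i (r n)) v - pairing \<Omega> (p i (r n)) d\<bar> \<le> C i * j ?w"
          using bd[OF w, of i "r n"] pairing_diff_right[OF p V_L1[OF v] V_L1[OF dV]] by simp
        also have "\<dots> \<le> (\<bar>C i\<bar> + 1) * s"
          using jw j0[OF w] by (intro mult_mono) auto
        also have "\<dots> = e / 3" by (simp add: s_def divide_simps add_nonneg_eq_0_iff)
        finally show ?thesis .
      qed
      from conv_D[OF d, of i] e obtain N where
        N: "\<And>m n. m \<ge> N \<Longrightarrow> n \<ge> N \<Longrightarrow> \<bar>pairing \<Omega> (p i (r m)) d - pairing \<Omega> (p i (r n)) d\<bar> < e / 3"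
        unfolding Cauchy_def dist_real_def by (metis divide_pos_pos zero_less_numeral)
      show "\<exists>N. \<forall>m\<ge>N. \<forall>n\<ge>N. \<bar>pairing \<Omega> (p i (r m)) v - pairing \<Omega> (p i (r n)) v\<bar> < e"
      proof (intro exI allI impI)
        fix m n assume "m \<ge> N" "n \<ge> N"
        with N[of m n] small[of m] small[of n]
        show "\<bar>pairing \<Omega> (p i (r m)) v - pairing \<Omega> (p i (r n)) v\<bar> < e" by linarith
      qed
    qed
    then have "\<exists>l. ((\<lambda>n. pairing \<Omega> (p i n) v) \<longlongrightarrow> l) (filtermap r sequentially)" if "v \<in> ?V" for i v
      using that by (simp add: filterlim_filtermap Cauchy_convergent_iff convergent_def)
    moreover have "subsequence_filter \<Omega> J (filtermap r sequentially)"
      using r filterlim_subseq[OF r]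
      by (auto simp: subsequence_filter_def filtermap_bot_iff filterlim_def)
    ultimately show ?thesis by blast
  qed
  then obtain F where F: "subsequence_filter \<Omega> J F"
    and lim: "\<And>i v. v \<in> ?V \<Longrightarrow> \<exists>l. ((\<lambda>n. pairing \<Omega> (p i n) v) \<longlongrightarrow> l) F" by blast
  have "\<exists>q. weak_star_lim \<Omega> J (p i) q F" for i
  proof -
    have nb: "F \<noteq> bot" using F by (simp add: subsequence_filter_def)
    obtain q where q: "\<And>v. v \<in> ?V \<Longrightarrow> ((\<lambda>n. pairing \<Omega> (p i n) v) \<longlongrightarrow> q v) F"
      using lim[of _ i] by metis
    have "q \<in> fin_dual \<Omega> J"
      unfolding fin_dual_def
    proof (intro CollectI conjI ballI allI)
      fix u assume u: "u \<in> ?V"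
      show "q (\<lambda>x. u x + v x) = q u + q v" if v: "v \<in> ?V" for v
        using tendsto_unique[OF nb q[OF fin_space_add[OF norm u v]]] tendsto_add[OF q[OF u] q[OF v]]
        by (simp add: pairing_add_right[OF p V_L1[OF u] V_L1[OF v]])
      show "q (\<lambda>x. c * u x) = c * q u" for c
        using tendsto_unique[OF nb q[OF fin_space_cmult[OF norm u]]] tendsto_mult_left[OF q[OF u]]
        by (simp add: pairing_cmult_right)
    next
      have "\<bar>q u\<bar> \<le> C i * j u" if u: "u \<in> ?V" for u
        by (rule tendsto_upperbound[OF tendsto_rabs[OF q[OF u]] _ nb]) (simp add: bd[OF u])
      then show "\<exists>c. \<forall>u\<in>?V. ereal \<bar>q u\<bar> \<le> ereal c * J u"
        by (intro exI[of _ "C i"]) (simp add: j)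
    qed
    with q show ?thesis by (auto simp: weak_star_lim_def)
  qed
  with F show ?thesis by blast
qed

section \<open>The dual problem\<close>

text \<open>Test the elements $\frac r2\,\mathrm{sgn}\,v$ of the ball of radius \<open>r\<close> inside
  $\partial\mathcal J(0)$ against \<open>v\<close>.\<close>
lemma interior_coercive:
  assumes "nonempty_interior_assumption \<Omega> J"
  shows "\<exists>c>0. \<forall>v\<in>L1 \<Omega>. ereal (c * l1_norm \<Omega> v) \<le> J v"
proof -
  obtain r where r: "r > 0" and sub: "\<And>g. g \<in> Linf \<Omega> \<Longrightarrow> linf_norm \<Omega> g < ereal r \<Longrightarrow> g \<in> subdiff \<Omega> J (\<lambda>_. 0)"
    using assms unfolding nonempty_interior_assumption_def by blast
  have "ereal (r / 2 * l1_norm \<Omega> v) \<le> J v" if v: "v \<in> L1 \<Omega>" for v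
  proof -
    define g where "g x = r / 2 * sgn (v x)" for x
    have [measurable]: "v \<in> borel_measurable (lebesgue_on \<Omega>)" using v by (simp add: L1_def)
    have m: "g \<in> borel_measurable (lebesgue_on \<Omega>)" unfolding g_def sgn_if by measurable
    have bd: "AE x in lebesgue_on \<Omega>. \<bar>g x\<bar> \<le> r / 2"
      using r by (intro AE_I2) (simp add: g_def abs_mult sgn_if)
    have "linf_norm \<Omega> g \<le> ereal (r / 2)" using bd m by (simp add: linf_norm_le_iff)
    also have "\<dots> < ereal r" using r by simp
    finally have "g \<in> subdiff \<Omega> J (\<lambda>_. 0)" by (intro sub LinfI[OF m bd])
    then have "ereal (pairing \<Omega> g v) \<le> J v" using v by (simp add: subdiff_def)
    moreover have "pairing \<Omega> g v = r / 2 * l1_norm \<Omega> v"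
    proof -
      have "(\<lambda>x. g x * v x) = (\<lambda>x. r / 2 * \<bar>v x\<bar>)" by (auto simp: g_def sgn_if)
      then show ?thesis by (simp add: pairing_def l1_norm_def)
    qed
    ultimately show ?thesis by simp
  qed
  with r show ?thesis by (intro exI[of _ "r / 2"]) auto
qed

lemma regulariser_zero: "regulariser \<Omega> J \<Longrightarrow> J (\<lambda>_. 0) = 0"
proof -
  assume J: "regulariser \<Omega> J"
  have "(\<lambda>_. 0) \<in> L1 \<Omega>" by (simp add: L1_def)
  moreover have "\<And>u c. u \<in> L1 \<Omega> \<Longrightarrow> J (\<lambda>x. c * u x) = ereal \<bar>c\<bar> * J u"
    using J unfolding regulariser_def by blast
  from this[of "\<lambda>_. 0" 0] calculation show ?thesis by (simp add: zero_ereal_def[symmetric])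
qed

lemma subdiff_zero_abs_le:
  assumes J: "regulariser \<Omega> J" and p: "p \<in> subdiff \<Omega> J (\<lambda>_. 0)" and v: "v \<in> L1 \<Omega>"
  shows "ereal \<bar>pairing \<Omega> p v\<bar> \<le> J v"
proof -
  have le: "ereal (pairing \<Omega> p w) \<le> J w" if "w \<in> L1 \<Omega>" for w
    using p that by (simp add: subdiff_def)
  have "J (\<lambda>x. (-1) * v x) = ereal \<bar>-1\<bar> * J v"
    using J v unfolding regulariser_def by blast
  with le[OF L1_cmult[OF v, of "-1"]] have "ereal (- pairing \<Omega> p v) \<le> J v"
    unfolding pairing_cmult_right by (simp add: one_ereal_def[symmetric])
  with le[OF v] show ?thesis by (simp add: abs_if)
qed

text \<open>Shrinking the source multiplier by $1-t$ gains $t\,\mathcal J(v)$ in the constraint, which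
  compensates the perturbation $(\nu,(A,-A)v-(L,-U)v)\leq|\nu|\,\eta\,\|v\|_1
  \leq\frac{|\nu|\eta}{c}\,\mathcal J(v)$. If the fraction exceeds 1, the zero multiplier is used.\<close>
lemma dual_feasible_shrunk_source:
  fixes \<eta> c :: real
  assumes dom: "bounded_domain \<Omega>" and J: "regulariser \<Omega> J"
    and c: "0 < c" "\<And>v. v \<in> L1 \<Omega> \<Longrightarrow> ereal (c * l1_norm \<Omega> v) \<le> J v"
    and A: "linear_op \<Omega> A" "bounded_op \<Omega> C A"
    and L: "linear_op \<Omega> L" "bounded_op \<Omega> C L" "bounded_op \<Omega> \<eta> (\<lambda>u x. A u x - L u x)"
    and U: "linear_op \<Omega> U" "bounded_op \<Omega> C U" "bounded_op \<Omega> \<eta> (\<lambda>u x. U u x - A u x)"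
    and \<eta>: "0 \<le> \<eta>"
    and \<nu>: "nonneg_multiplier \<Omega> \<nu>" "(\<lambda>x. - adjoint_op \<Omega> (op_pair A A) \<nu> x) \<in> subdiff \<Omega> J w"
    and t: "t = min 1 (mass \<nu> * \<eta> / c)"
  shows "dual_feasible \<Omega> J (op_pair L U) (\<lambda>_. 0) (\<lambda>g. (1 - t) * fst \<nu> g, \<lambda>g. (1 - t) * snd \<nu> g)"
proof -
  let ?\<nu> = "(\<lambda>g. (1 - t) * fst \<nu> g, \<lambda>g. (1 - t) * snd \<nu> g)"
  have mass0: "0 \<le> mass \<nu>" by (rule mass_nonneg[OF \<nu>(1)])
  have t01: "0 \<le> t" "t \<le> 1" using t mass0 \<eta> c(1) by auto
  have scaled: "(\<lambda>g. (1 - t) * m g) \<in> Linf_dual \<Omega>" if m: "m \<in> Linf_dual \<Omega>" for m :: "'a functional"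
  proof -
    obtain K where K: "\<And>g. g \<in> Linf \<Omega> \<Longrightarrow> ereal \<bar>m g\<bar> \<le> ereal K * linf_norm \<Omega> g"
      using m unfolding Linf_dual_def by blast
    have "ereal \<bar>(1 - t) * m g\<bar> \<le> ereal K * linf_norm \<Omega> g" if "g \<in> Linf \<Omega>" for g
    proof -
      have "\<bar>(1 - t) * m g\<bar> \<le> \<bar>m g\<bar>"
        using t01 by (simp add: abs_mult mult_left_le_one_le)
      then show ?thesis using K[OF that] by (meson ereal_less_eq(3) order_trans)
    qed
    then show ?thesis
      using functional_add[OF m] functional_cmult[OF m]
      unfolding Linf_dual_def by (auto simp: distrib_left mult.left_commute)
  qed
  have \<nu>': "nonneg_multiplier \<Omega> ?\<nu>"
    using \<nu>(1) t01 by (auto simp: nonneg_multiplier_def functional_nonneg_def intro: scaled)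
  have dp: "dpairing ?\<nu> a = (1 - t) * dpairing \<nu> a" for a
    by (simp add: dpairing_def distrib_left)
  note adj = adjoint_op_represents[OF dom \<nu>' L(1,2) U(1,2)]
  note adjA = adjoint_op_represents[OF dom \<nu>(1) A A]
  have "ereal (pairing \<Omega> (\<lambda>x. 0 - adjoint_op \<Omega> (op_pair L U) ?\<nu> x) v) \<le> J v" if v: "v \<in> L1 \<Omega>" for v
  proof (cases "J v")
    case (real j)
    have cj: "c * l1_norm \<Omega> v \<le> j" using c(2)[OF v] real by simp
    have j0: "0 \<le> j" using cj c(1) l1_norm_nonneg[of \<Omega> v] by (meson mult_nonneg_nonneg less_imp_le order_trans)
    have "- dpairing \<nu> (op_pair A A v) = pairing \<Omega> (\<lambda>x. - adjoint_op \<Omega> (op_pair A A) \<nu> x) v"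
      using adjA(2)[OF v] by (simp add: pairing_uminus_left)
    moreover have "ereal \<dots> \<le> J v" using \<nu>(2) v by (simp add: subdiff_def)
    ultimately have src: "- dpairing \<nu> (op_pair A A v) \<le> j" using real by simp
    let ?d = "pair_diff (op_pair A A v) (op_pair L U v)"
    note in1 = op_pair_Linf[OF A(1) A(1) v] and in2 = op_pair_Linf[OF L(1) U(1) v]
    have "AE x in lebesgue_on \<Omega>. \<bar>A v x - L v x\<bar> \<le> \<eta> * l1_norm \<Omega> v"
      "AE x in lebesgue_on \<Omega>. \<bar>U v x - A v x\<bar> \<le> \<eta> * l1_norm \<Omega> v"
      using L(3) U(3) v unfolding bounded_op_def by blast+
    moreover have "?d \<in> Linf \<Omega> \<times> Linf \<Omega>"
      using in1 in2 unfolding pair_diff_def by (intro SigmaI Linf_diff) auto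
    ultimately have "\<bar>dpairing \<nu> ?d\<bar> \<le> \<eta> * l1_norm \<Omega> v * mass \<nu>"
      by (intro dpairing_abs_le[OF \<nu>(1)]) (auto simp: pair_diff_def op_pair_def)
    then have "dpairing \<nu> ?d \<le> (mass \<nu> * \<eta> / c) * (c * l1_norm \<Omega> v)"
      using c(1) by (simp add: mult_ac)
    also have "\<dots> \<le> (mass \<nu> * \<eta> / c) * j"
      using cj mass0 \<eta> c(1) by (intro mult_left_mono) auto
    finally have pert: "dpairing \<nu> (op_pair A A v) - dpairing \<nu> (op_pair L U v) \<le> (mass \<nu> * \<eta> / c) * j"
      using dpairing_diff[OF \<nu>(1) in1 in2] by simp
    have "(1 - t) * - dpairing \<nu> (op_pair L U v) \<le> (1 - t) * (j + (mass \<nu> * \<eta> / c) * j)"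
      using src pert t01 by (intro mult_left_mono) auto
    also have "\<dots> \<le> j"
    proof (cases "mass \<nu> * \<eta> / c \<le> 1")
      case True
      then have "t = mass \<nu> * \<eta> / c" using t by simp
      then have "(1 - t) * (j + (mass \<nu> * \<eta> / c) * j) = (1 - t) * (j + t * j)" by simp
      also have "\<dots> = j - t * t * j" by (simp add: algebra_simps)
      finally show ?thesis using j0 by simp
    next
      case False
      then show ?thesis using t j0 by simp
    qed
    finally show ?thesis
      using adj(2)[OF v] real by (simp add: pairing_uminus_left dp)
  qed (use J v in \<open>auto simp: regulariser_def\<close>)
  moreover have "(\<lambda>x. 0 - adjoint_op \<Omega> (op_pair L U) ?\<nu> x) \<in> Linf \<Omega>"
    using adj(1) by (intro Linf_diff) auto
  ultimately show ?thesis
    using \<nu>' regulariser_zero[OF J]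
    by (simp add: dual_feasible_def dual_variable_def subdiff_def ae_le_def pairing_def zero_ereal_def)
qed

text \<open>The central inequality. With $\phi=(f_u,-f_l)$ and $\bar\phi=(f,-f)$, the value $(\mu,\phi)$ is
  bounded above through optimality against the shrunk source multiplier, where
  $(\nu,\bar\phi)=(\nu,\bar Bw)=-\mathcal J(w)$ by the source condition. It is bounded below through
  $(\mu,\phi)\geq\varepsilon|\mu|+(\mu,\bar\phi)$ and
  $(\mu,\bar\phi)=(\mu,\bar Bu)\geq(\mu,Bu)=(\lambda-p,u)$, the latter because $u\geq0$.\<close>
lemma dual_optimality_estimate:
  fixes \<eta> c \<epsilon> C0 j :: real
  assumes dom: "bounded_domain \<Omega>" and J: "regulariser \<Omega> J"
    and c: "0 < c" "\<And>v. v \<in> L1 \<Omega> \<Longrightarrow> ereal (c * l1_norm \<Omega> v) \<le> J v"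
    and A: "linear_op \<Omega> A" "bounded_op \<Omega> C A"
    and L: "linear_op \<Omega> L" "bounded_op \<Omega> C L" "bounded_op \<Omega> \<eta> (\<lambda>u x. A u x - L u x)" "op_le \<Omega> L A"
    and U: "linear_op \<Omega> U" "bounded_op \<Omega> C U" "bounded_op \<Omega> \<eta> (\<lambda>u x. U u x - A u x)" "op_le \<Omega> A U"
    and f: "f \<in> Linf \<Omega>" "fl \<in> Linf \<Omega>" "fu \<in> Linf \<Omega>"
    and fu: "AE x in lebesgue_on \<Omega>. \<epsilon> \<le> fu x - f x" "AE x in lebesgue_on \<Omega>. fu x - f x \<le> C0 * \<epsilon>"
    and fl: "AE x in lebesgue_on \<Omega>. \<epsilon> \<le> f x - fl x" "AE x in lebesgue_on \<Omega>. f x - fl x \<le> C0 * \<epsilon>"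
    and pos: "0 \<le> \<eta>" "0 \<le> \<epsilon>" "0 \<le> C0"
    and \<nu>: "nonneg_multiplier \<Omega> \<nu>" "(\<lambda>x. - adjoint_op \<Omega> (op_pair A A) \<nu> x) \<in> subdiff \<Omega> J w"
    and w: "nonneg_solution \<Omega> A f w" "J w = ereal j"
    and u: "nonneg_solution \<Omega> A f u" "J u = ereal j"
    and sol: "dual_solution \<Omega> J (op_pair L U) (data_pair fu fl) lam \<mu>"
  defines "p \<equiv> dual_variable \<Omega> (op_pair L U) lam \<mu>"
  shows "\<epsilon> * mass \<mu> + pairing \<Omega> lam u + (j - pairing \<Omega> p u) \<le> mass \<nu> * \<eta> / c * j + C0 * \<epsilon> * mass \<nu>"
proof -
  let ?B = "op_pair L U" and ?A = "op_pair A A" and ?\<phi> = "data_pair fu fl" and ?f = "data_pair f f"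
  define t where "t = min 1 (mass \<nu> * \<eta> / c)"
  have \<mu>: "nonneg_multiplier \<Omega> \<mu>" and lam: "lam \<in> Linf \<Omega>"
    using sol by (auto simp: dual_solution_def dual_feasible_def)
  have uL1: "u \<in> L1 \<Omega>" and u0: "ae_nonneg \<Omega> u" and Au: "AE x in lebesgue_on \<Omega>. A u x = f x"
    using u(1) by (auto simp: nonneg_solution_def ae_eq_def)
  have wL1: "w \<in> L1 \<Omega>" and Aw: "AE x in lebesgue_on \<Omega>. A w x = f x"
    using w(1) by (auto simp: nonneg_solution_def ae_eq_def)
  have \<phi>in: "?\<phi> \<in> Linf \<Omega> \<times> Linf \<Omega>" and fin: "?f \<in> Linf \<Omega> \<times> Linf \<Omega>"
    using f by (auto simp: data_pair_def Linf_uminus)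
  have din: "pair_diff ?\<phi> ?f \<in> Linf \<Omega> \<times> Linf \<Omega>"
    using \<phi>in fin by (auto simp: pair_diff_def intro: Linf_diff)
  have data: "dpairing m ?f = dpairing m (?A v)"
    if m: "nonneg_multiplier \<Omega> m" and v: "v \<in> L1 \<Omega>" "AE x in lebesgue_on \<Omega>. A v x = f x" for m v
    using op_pair_Linf[OF A(1) A(1) v(1)] fin v(2)
    by (intro antisym dpairing_mono[OF m]) (auto simp: op_pair_def data_pair_def elim: eventually_mono)
  have mass0: "0 \<le> mass \<nu>" by (rule mass_nonneg[OF \<nu>(1)])
  have j0: "0 \<le> j" using J wL1 w(2) unfolding regulariser_def by fastforce
  have t: "t \<le> 1" "0 \<le> t" "t \<le> mass \<nu> * \<eta> / c"
    using mass0 pos(1) c(1) by (auto simp: t_def)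

  have "dual_feasible \<Omega> J ?B (\<lambda>_. 0) (\<lambda>g. (1 - t) * fst \<nu> g, \<lambda>g. (1 - t) * snd \<nu> g)"
    by (rule dual_feasible_shrunk_source[OF dom J c A L(1-3) U(1-3) pos(1) \<nu> t_def])
  then have "dpairing (\<lambda>g. (1 - t) * fst \<nu> g, \<lambda>g. (1 - t) * snd \<nu> g) (pair_neg ?\<phi>) \<le> dpairing \<mu> (pair_neg ?\<phi>)"
    using sol unfolding dual_solution_def by blast
  moreover have "dpairing (\<lambda>g. (1 - t) * fst \<nu> g, \<lambda>g. (1 - t) * snd \<nu> g) a = (1 - t) * dpairing \<nu> a" for a
    by (simp add: dpairing_def distrib_left)
  ultimately have opt: "dpairing \<mu> ?\<phi> \<le> (1 - t) * dpairing \<nu> ?\<phi>"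
    using dpairing_neg[OF \<mu> \<phi>in] dpairing_neg[OF \<nu>(1) \<phi>in] by simp

  have "j = pairing \<Omega> (\<lambda>x. - adjoint_op \<Omega> ?A \<nu> x) w"
    using \<nu>(2) w(2) by (simp add: subdiff_def)
  then have src: "dpairing \<nu> ?f = - j"
    using adjoint_op_represents(2)[OF dom \<nu>(1) A A wL1] data[OF \<nu>(1) wL1 Aw] by (simp add: pairing_uminus_left)
  have "dpairing \<nu> (pair_diff ?\<phi> ?f) \<le> C0 * \<epsilon> * mass \<nu>"
    using fu fl by (intro dpairing_le[OF \<nu>(1) din]) (auto simp: pair_diff_def data_pair_def)
  then have "dpairing \<nu> ?\<phi> \<le> C0 * \<epsilon> * mass \<nu> - j"
    using dpairing_diff[OF \<nu>(1) \<phi>in fin] src by simp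
  then have "(1 - t) * dpairing \<nu> ?\<phi> \<le> (1 - t) * (C0 * \<epsilon> * mass \<nu> - j)"
    using t by (intro mult_left_mono) auto
  also have "\<dots> = (1 - t) * (C0 * \<epsilon> * mass \<nu>) + t * j - j" by (simp add: algebra_simps)
  also have "\<dots> \<le> C0 * \<epsilon> * mass \<nu> + mass \<nu> * \<eta> / c * j - j"
    using t mass0 pos j0 by (intro diff_right_mono add_mono mult_left_le_one_le mult_right_mono) auto
  finally have upper: "dpairing \<mu> ?\<phi> \<le> C0 * \<epsilon> * mass \<nu> + mass \<nu> * \<eta> / c * j - j"
    using opt by simp

  have "\<epsilon> * mass \<mu> \<le> dpairing \<mu> (pair_diff ?\<phi> ?f)"
    using fu fl by (intro dpairing_ge[OF \<mu> din]) (auto simp: pair_diff_def data_pair_def)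
  then have 1: "\<epsilon> * mass \<mu> + dpairing \<mu> ?f \<le> dpairing \<mu> ?\<phi>"
    using dpairing_diff[OF \<mu> \<phi>in fin] by simp
  have "AE x in lebesgue_on \<Omega>. L u x \<le> A u x" "AE x in lebesgue_on \<Omega>. A u x \<le> U u x"
    using L(4) U(4) uL1 u0 by (auto simp: op_le_def ae_le_def)
  then have 2: "dpairing \<mu> (?B u) \<le> dpairing \<mu> (?A u)"
    using op_pair_Linf[OF A(1) A(1) uL1] op_pair_Linf[OF L(1) U(1) uL1]
    by (intro dpairing_mono[OF \<mu>]) (auto simp: op_pair_def)
  note adj = adjoint_op_represents[OF dom \<mu> L(1,2) U(1,2)]
  have 3: "pairing \<Omega> p u = pairing \<Omega> lam u - dpairing \<mu> (?B u)"
    using pairing_diff_left[OF lam adj(1) uL1] adj(2)[OF uL1] by (simp add: p_def dual_variable_def)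
  from 1 2 3 upper data[OF \<mu> uL1 Au] show ?thesis by simp
qed

text \<open>Since all \<open>\<epsilon> n\<close> are positive, the asymptotic bound on the ratio holds for every \<open>n\<close> after
  enlarging the constant; so no initial segment of the sequences has to be discarded later.\<close>
lemma limsup_ratio_bounded:
  fixes \<epsilon> \<eta> :: "nat \<Rightarrow> real"
  assumes \<epsilon>: "\<And>n. 0 < \<epsilon> n" and \<eta>: "\<And>n. 0 \<le> \<eta> n"
    and ratio: "limsup (\<lambda>n. ereal (\<eta> n / \<epsilon> n)) \<le> ereal D"
  shows "\<exists>K. \<forall>n. \<eta> n \<le> K * \<epsilon> n"
proof -
  have "limsup (\<lambda>n. ereal (\<eta> n / \<epsilon> n)) < ereal (D + 1)"
    using ratio by (rule le_less_trans) simp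
  then have "eventually (\<lambda>n. ereal (\<eta> n / \<epsilon> n) < ereal (D + 1)) sequentially"
    by (rule Limsup_lessD)
  then have "eventually (\<lambda>n. norm (\<eta> n / \<epsilon> n) \<le> D + 1) sequentially"
    by eventually_elim (use \<epsilon> \<eta> in \<open>simp add: less_imp_le abs_of_nonneg\<close>)
  then have "Bseq (\<lambda>n. \<eta> n / \<epsilon> n)" by (rule BfunI)
  then obtain K where "0 < K" "\<And>n. norm (\<eta> n / \<epsilon> n) \<le> K" by (auto elim: BseqE)
  then have le: "\<eta> n / \<epsilon> n \<le> K" for n by (metis abs_le_D1 real_norm_def)
  have "\<eta> n \<le> K * \<epsilon> n" for n
    using le[of n] \<epsilon>[of n] by (simp add: pos_divide_le_eq)
  then show ?thesis by blast
qed

theorem theorem17: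
  fixes \<Omega> :: "(real ^ 'm::finite) set"
    and J :: "'m func \<Rightarrow> ereal"
    and A :: "'m func \<Rightarrow> 'm func" and Al Au :: "nat \<Rightarrow> 'm func \<Rightarrow> 'm func"
    and f ubar :: "'m func" and fl fu :: "nat \<Rightarrow> 'm func"
    and lam :: "nat \<Rightarrow> 'm func" and \<mu> :: "nat \<Rightarrow> 'm functional \<times> 'm functional"
  assumes domain: "bounded_domain \<Omega>"
    and J: "regulariser \<Omega> J"
    and J_norm: "is_norm_on_fin_space \<Omega> J"
    and f_bounds: "data_bounds \<Omega> f fl fu"
    and A_bounds: "operator_bounds \<Omega> A Al Au"
    and solvable: "\<exists>u. nonneg_solution \<Omega> A f u \<and> J u < \<infinity>"
    and minimiser: "J_minimising \<Omega> J A f ubar"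
    and conv: "convergence_assumption \<Omega> (\<lambda>n. op_pair (Al n) (Au n)) (op_pair A A)
                 (\<lambda>n. data_pair (fu n) (fl n)) (data_pair f f)"
    and source: "source_condition \<Omega> J (op_pair A A) ubar"
    and interior: "nonempty_interior_assumption \<Omega> J"
    and dual: "\<And>n. dual_solution \<Omega> J (op_pair (Al n) (Au n)) (data_pair (fu n) (fl n)) (lam n) (\<mu> n)"
  shows "\<exists>F. subsequence_filter \<Omega> J F \<and>
    (\<exists>phat. weak_star_lim \<Omega> J (\<lambda>n. dual_variable \<Omega> (op_pair (Al n) (Au n)) (lam n) (\<mu> n)) phat F \<and>
       (\<forall>u. J_minimising \<Omega> J A f u \<longrightarrow> phat \<in> fin_subdiff \<Omega> J u)) \<and>
    (\<exists>lamhat. weak_star_lim \<Omega> J lam lamhat F \<and>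
       (\<forall>u\<in>fin_space \<Omega> J. ae_nonneg \<Omega> u \<longrightarrow> 0 \<le> lamhat u) \<and>
       (\<forall>u. J_minimising \<Omega> J A f u \<longrightarrow> lamhat u = 0))"
proof -
  let ?V = "fin_space \<Omega> J"
  let ?B = "\<lambda>n. op_pair (Al n) (Au n)"
  let ?p = "\<lambda>n. dual_variable \<Omega> (?B n) (lam n) (\<mu> n)"
  obtain c where c: "0 < c" "\<And>v. v \<in> L1 \<Omega> \<Longrightarrow> ereal (c * l1_norm \<Omega> v) \<le> J v"
    using interior_coercive[OF interior] by blast
  obtain \<nu> where \<nu>: "nonneg_multiplier \<Omega> \<nu>"
    "(\<lambda>x. - adjoint_op \<Omega> (op_pair A A) \<nu> x) \<in> subdiff \<Omega> J ubar"
    using source unfolding source_condition_def by blast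
  obtain \<epsilon> \<eta> :: "nat \<Rightarrow> real" and C0 D0 :: real
    where \<epsilon>: "\<And>n. 0 < \<epsilon> n" "\<epsilon> \<longlonglongrightarrow> 0" and \<eta>: "decseq \<eta>" "\<eta> \<longlonglongrightarrow> 0" and C0: "1 \<le> C0"
      and gap: "\<And>n. let d = pair_diff (data_pair (fu n) (fl n)) (data_pair f f) in
             ae_le \<Omega> (\<lambda>_. \<epsilon> n) (fst d) \<and> ae_le \<Omega> (fst d) (\<lambda>_. C0 * \<epsilon> n) \<and>
             ae_le \<Omega> (\<lambda>_. \<epsilon> n) (snd d) \<and> ae_le \<Omega> (snd d) (\<lambda>_. C0 * \<epsilon> n)"
      and op_gap: "\<And>n. op_norm \<Omega> (linf_norm2 \<Omega>) (\<lambda>u. pair_diff (op_pair A A u) (?B n u)) \<le> ereal (\<eta> n)"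
      and ratio: "limsup (\<lambda>n. ereal (\<eta> n / \<epsilon> n)) \<le> ereal D0"
    using conv unfolding convergence_assumption_def by auto
  have \<eta>0: "0 \<le> \<eta> n" for n using decseq_ge[OF \<eta>] .
  have mass0: "0 \<le> mass \<nu>" by (rule mass_nonneg[OF \<nu>(1)])

  have linA: "linear_op \<Omega> A" and reg: "\<And>n. regular_op \<Omega> (Al n)" "\<And>n. regular_op \<Omega> (Au n)"
    and ord: "\<And>n. op_le \<Omega> (Al n) A" "\<And>n. op_le \<Omega> A (Au n)"
    using A_bounds unfolding operator_bounds_def by auto
  have lin: "linear_op \<Omega> (Al n)" "linear_op \<Omega> (Au n)" for n
    using reg by (simp_all add: regular_op_def)
  obtain CA where CA: "bounded_op \<Omega> CA A"
    using regular_minorant_bounded[OF domain linA reg(1) ord(1)] by blast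
  note gapL = op_norm_gap_bounded(1)[OF linA lin op_gap]
    and gapU = op_norm_gap_bounded(2)[OF linA lin op_gap]
  \<comment> \<open>One constant bounds \<open>A\<close> and, as \<open>\<eta>\<close> decreases, all \<open>Al n\<close> and \<open>Au n\<close>.\<close>
  define C where "C = \<bar>CA\<bar> + \<eta> 0"
  have C_ge: "CA + \<eta> n \<le> C" "CA \<le> C" for n
    using decseqD[OF \<eta>(1), of 0 n] \<eta>0[of 0] by (auto simp: C_def)
  have bdA: "bounded_op \<Omega> C A" by (rule bounded_op_mono[OF CA C_ge(2)])
  have bdL: "bounded_op \<Omega> C (Al n)" for n
    by (rule bounded_op_mono[OF bounded_op_cong[OF bounded_op_diff[OF CA gapL[of n]]] C_ge(1)[of n]]) simp
  have bdU: "bounded_op \<Omega> C (Au n)" for n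
  proof (rule bounded_op_mono[OF bounded_op_cong[OF bounded_op_diff[OF gapU[of n] bounded_op_uminus[OF CA]]]])
    show "\<eta> n + CA \<le> C" using C_ge(1)[of n] by simp
  qed simp

  obtain K where K: "\<And>n. \<eta> n \<le> K * \<epsilon> n"
    using limsup_ratio_bounded[OF \<epsilon>(1) \<eta>0 ratio] by blast

  obtain j where j: "J ubar = ereal j"
  proof -
    obtain v where "nonneg_solution \<Omega> A f v" "J v < \<infinity>" using solvable by blast
    then have "J ubar < \<infinity>" using minimiser unfolding J_minimising_def by (metis le_less_trans)
    moreover have "0 \<le> J ubar"
      using J minimiser by (simp add: regulariser_def J_minimising_def nonneg_solution_def)
    ultimately show thesis using that by (cases "J ubar") auto
  qed
  have ubar: "nonneg_solution \<Omega> A f ubar" using minimiser by (simp add: J_minimising_def)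
  have "0 \<le> J ubar" using J ubar by (simp add: regulariser_def nonneg_solution_def)
  then have j0: "0 \<le> j" using j by simp
  have min_val: "J u = ereal j" if "J_minimising \<Omega> J A f u" for u
    using that minimiser j unfolding J_minimising_def by (metis antisym)

  have \<mu>: "nonneg_multiplier \<Omega> (\<mu> n)" and lam: "lam n \<in> Linf \<Omega>" "ae_nonneg \<Omega> (lam n)"
    and p: "?p n \<in> subdiff \<Omega> J (\<lambda>_. 0)" for n
    using dual[of n] by (auto simp: dual_solution_def dual_feasible_def)
  note adj = adjoint_op_represents[OF domain \<mu> lin(1) bdL lin(2) bdU]
  have p_Linf: "?p n \<in> Linf \<Omega>" for n using p[of n] by (simp add: subdiff_def)
  have lam_split: "pairing \<Omega> (lam n) v = pairing \<Omega> (?p n) v + dpairing (\<mu> n) (?B n v)" if "v \<in> L1 \<Omega>" for n v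
    using pairing_diff_left[OF lam(1) adj(1) that, of n n] adj(2)[OF that, of n]
    by (simp add: dual_variable_def)

  define R where "R = mass \<nu> * K / c * j + C0 * mass \<nu>"
  have est: "\<epsilon> n * mass (\<mu> n) + pairing \<Omega> (lam n) u + (j - pairing \<Omega> (?p n) u) \<le> R * \<epsilon> n"
    if u: "J_minimising \<Omega> J A f u" for n u
  proof -
    have g: "AE x in lebesgue_on \<Omega>. \<epsilon> n \<le> fu n x - f x" "AE x in lebesgue_on \<Omega>. fu n x - f x \<le> C0 * \<epsilon> n"
      "AE x in lebesgue_on \<Omega>. \<epsilon> n \<le> f x - fl n x" "AE x in lebesgue_on \<Omega>. f x - fl n x \<le> C0 * \<epsilon> n"
      using gap[of n] by (simp_all add: pair_diff_def data_pair_def Let_def ae_le_def)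
    have fin: "f \<in> Linf \<Omega>" "fl n \<in> Linf \<Omega>" "fu n \<in> Linf \<Omega>"
      using f_bounds by (auto simp: data_bounds_def)
    have sol_u: "nonneg_solution \<Omega> A f u" using u by (simp add: J_minimising_def)
    have "\<epsilon> n * mass (\<mu> n) + pairing \<Omega> (lam n) u + (j - pairing \<Omega> (?p n) u)
        \<le> mass \<nu> * \<eta> n / c * j + C0 * \<epsilon> n * mass \<nu>"
      by (rule dual_optimality_estimate[OF domain J c linA bdA lin(1) bdL gapL ord(1) lin(2) bdU gapU ord(2)
            fin g \<eta>0 less_imp_le[OF \<epsilon>(1)] order_trans[OF zero_le_one C0]
            \<nu> ubar j sol_u min_val[OF u] dual])
    also have "\<dots> \<le> mass \<nu> * (K * \<epsilon> n) / c * j + C0 * \<epsilon> n * mass \<nu>"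
      using K[of n] mass0 c(1) j0
      by (intro add_right_mono mult_right_mono divide_right_mono mult_left_mono) auto
    also have "\<dots> = R * \<epsilon> n" by (simp add: R_def algebra_simps)
    finally show ?thesis .
  qed
  have p_le: "ereal \<bar>pairing \<Omega> (?p n) v\<bar> \<le> J v" if "v \<in> L1 \<Omega>" for n v
    by (rule subdiff_zero_abs_le[OF J p that])
  have terms: "0 \<le> \<epsilon> n * mass (\<mu> n)" "0 \<le> pairing \<Omega> (lam n) u" "pairing \<Omega> (?p n) u \<le> j"
    if u: "J_minimising \<Omega> J A f u" for n u
  proof -
    have "u \<in> L1 \<Omega>" "ae_nonneg \<Omega> u" using u by (auto simp: J_minimising_def nonneg_solution_def)
    then show "0 \<le> pairing \<Omega> (lam n) u" "pairing \<Omega> (?p n) u \<le> j"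
      using p_le[of u n] min_val[OF u] pairing_nonneg[OF lam(2)] by auto
    show "0 \<le> \<epsilon> n * mass (\<mu> n)" using \<epsilon>(1)[of n] mass_nonneg[OF \<mu>[of n]] by simp
  qed
  have mass_le: "mass (\<mu> n) \<le> R" for n
  proof -
    have "\<epsilon> n * mass (\<mu> n) \<le> \<epsilon> n * R"
      using est[OF minimiser, of n] terms[OF minimiser, of n] by (simp add: mult.commute)
    then show ?thesis using \<epsilon>(1)[of n] by simp
  qed
  have R0: "0 \<le> R" using mass_le[of 0] mass_nonneg[OF \<mu>[of 0]] by simp
  have C_nonneg: "0 \<le> C" using \<eta>0[of 0] by (simp add: C_def)

  have lam_bd: "ereal \<bar>pairing \<Omega> (lam n) v\<bar> \<le> ereal (1 + C * R / c) * J v" if v: "v \<in> ?V" for n v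
  proof -
    have vL1: "v \<in> L1 \<Omega>" using v by (simp add: fin_space_def)
    obtain k where k: "J v = ereal k" using v J by (cases "J v") (auto simp: fin_space_def regulariser_def)
    have "\<bar>dpairing (\<mu> n) (?B n v)\<bar> \<le> C * l1_norm \<Omega> v * mass (\<mu> n)"
      by (rule dpairing_op_pair_abs_le[OF \<mu> lin bdL bdU vL1])
    also have "\<dots> \<le> C * l1_norm \<Omega> v * R"
      using mass_le[of n] C_nonneg l1_norm_nonneg[of \<Omega> v] by (intro mult_left_mono) auto
    also have "\<dots> = C * R / c * (c * l1_norm \<Omega> v)" using c(1) by simp
    also have "\<dots> \<le> C * R / c * k"
      using c(2)[OF vL1] k C_nonneg R0 c(1) by (intro mult_left_mono) auto
    finally have "\<bar>pairing \<Omega> (lam n) v\<bar> \<le> k + C * R / c * k"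
      using p_le[OF vL1, of n] k lam_split[OF vL1, of n] by simp
    then show ?thesis using k by (simp add: distrib_right)
  qed
  have p_bd: "ereal \<bar>pairing \<Omega> (?p n) v\<bar> \<le> ereal 1 * J v" if "v \<in> ?V" for n v
    using p_le[of v n] that by (simp add: fin_space_def one_ereal_def[symmetric])

  have "\<exists>F. subsequence_filter \<Omega> J F \<and>
      (\<forall>b. \<exists>q. weak_star_lim \<Omega> J (if b then ?p else lam) q F)"
  proof (rule weak_star_compactness[OF J_norm, where C="\<lambda>b. if b then 1 else 1 + C * R / c"])
    show "(if b then ?p else lam) n \<in> Linf \<Omega>" for b n using p_Linf lam(1) by simp
    show "ereal \<bar>pairing \<Omega> ((if b then ?p else lam) n) v\<bar> \<le> ereal (if b then 1 else 1 + C * R / c) * J v"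
      if "v \<in> ?V" for b n v
      using p_bd[OF that] lam_bd[OF that] by simp
  qed
  then obtain F where F: "subsequence_filter \<Omega> J F"
    and lims: "\<And>b. \<exists>q. weak_star_lim \<Omega> J (if b then ?p else lam) q F" by blast
  obtain phat lamhat where phat: "weak_star_lim \<Omega> J ?p phat F"
    and lamhat: "weak_star_lim \<Omega> J lam lamhat F"
    using lims[of True] lims[of False] by auto
  have nb: "F \<noteq> bot" and Fseq: "F \<le> sequentially" using F by (auto simp: subsequence_filter_def)
  have lim_p: "((\<lambda>n. pairing \<Omega> (?p n) v) \<longlongrightarrow> phat v) F"
    and lim_lam: "((\<lambda>n. pairing \<Omega> (lam n) v) \<longlongrightarrow> lamhat v) F" if "v \<in> ?V" for v
    using phat lamhat that by (auto simp: weak_star_lim_def)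
  have R\<epsilon>: "((\<lambda>n. R * \<epsilon> n) \<longlongrightarrow> 0) F"
    using tendsto_mult_right_zero[OF tendsto_mono[OF Fseq \<epsilon>(2)]] .
  have min_V: "u \<in> ?V" if "J_minimising \<Omega> J A f u" for u
    using that min_val[OF that] by (simp add: fin_space_def J_minimising_def nonneg_solution_def)

  have "phat \<in> fin_subdiff \<Omega> J u" if u: "J_minimising \<Omega> J A f u" for u
  proof -
    have "ereal (phat v) \<le> J v" if v: "v \<in> ?V" for v
    proof -
      obtain k where k: "J v = ereal k" using v J by (cases "J v") (auto simp: fin_space_def regulariser_def)
      have "pairing \<Omega> (?p n) v \<le> k" for n using p_bd[OF v, of n] k by (simp add: one_ereal_def[symmetric])
      then have "phat v \<le> k"
        by (intro tendsto_upperbound[OF lim_p[OF v] _ nb]) simp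
      then show ?thesis using k by simp
    qed
    moreover have "((\<lambda>n. j - pairing \<Omega> (?p n) u) \<longlongrightarrow> 0) F"
    proof (rule tendsto_sandwich[OF _ _ tendsto_const R\<epsilon>])
      show "\<forall>\<^sub>F n in F. 0 \<le> j - pairing \<Omega> (?p n) u" using terms[OF u] by simp
      show "\<forall>\<^sub>F n in F. j - pairing \<Omega> (?p n) u \<le> R * \<epsilon> n"
      proof (rule always_eventually, rule allI)
        show "j - pairing \<Omega> (?p n) u \<le> R * \<epsilon> n" for n using est[OF u, of n] terms[OF u, of n] by linarith
      qed
    qed
    then have "j - phat u = 0"
      using tendsto_unique[OF nb tendsto_diff[OF tendsto_const lim_p[OF min_V[OF u]]]] by blast
    ultimately show ?thesis
      using phat min_val[OF u] by (simp add: fin_subdiff_def weak_star_lim_def)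
  qed
  moreover have "0 \<le> lamhat u" if "u \<in> ?V" "ae_nonneg \<Omega> u" for u
    by (rule tendsto_lowerbound[OF lim_lam[OF that(1)] _ nb]) (simp add: pairing_nonneg lam(2) that(2))
  moreover have "lamhat u = 0" if u: "J_minimising \<Omega> J A f u" for u
  proof (rule tendsto_unique[OF nb lim_lam[OF min_V[OF u]]])
    show "((\<lambda>n. pairing \<Omega> (lam n) u) \<longlongrightarrow> 0) F"
    proof (rule tendsto_sandwich[OF _ _ tendsto_const R\<epsilon>])
      show "\<forall>\<^sub>F n in F. 0 \<le> pairing \<Omega> (lam n) u" using terms[OF u] by simp
      show "\<forall>\<^sub>F n in F. pairing \<Omega> (lam n) u \<le> R * \<epsilon> n"
      proof (rule always_eventually, rule allI)
        show "pairing \<Omega> (lam n) u \<le> R * \<epsilon> n" for n using est[OF u, of n] terms[OF u, of n] by linarith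
      qed
    qed
  qed
  ultimately show ?thesis using F phat lamhat by blast
qed

end
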